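(* Let $n \ge 1$ and $m \ge 1$ be integers, let $\lambda > 1$ be a real number, and let $a_\alpha$, $a$, $b$, $f$ be as in the context (in particular $b(x) \ge a^\lambda(x) f(x)$ for almost all $x$). Suppose that for some real number $\sigma > 1$, $$\int_1^\infty r^{(m - n)\lambda + n - 1} q(r)\, dr = \infty, \qquad \text{where } q(r) = \left( \frac{1}{r^n} \int_{B_{\sigma r} \setminus B_{r/\sigma}} f^{-1/(\lambda-1)}(x)\, dx \right)^{1-\lambda},$$ with the convention that $q(r) = 0$ whenever the integral inside the parentheses equals $\infty$. Then every solution $u$ of the inequality $$\sum_{|\alpha| = m} (-1)^m \partial^\alpha a_\alpha(x, u) \ge b(x) |u|^\lambda \quad \text{in } \mathbb{R}^n$$ is trivial, i.e. $u(x) = 0$ for almost all $x \in \mathbb{R}^n$.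
   Context: For each multi-index $\alpha = (\alpha_1,\dots,\alpha_n)$ with $|\alpha| = \alpha_1 + \dots + \alpha_n = m$, $a_\alpha : \mathbb{R}^n \times \mathbb{R} \to \mathbb{R}$ is a given function, and $\partial^\alpha = \partial^{|\alpha|}/\partial x_1^{\alpha_1}\cdots\partial x_n^{\alpha_n}$. The function $b : \mathbb{R}^n \to (0,\infty)$ is positive and measurable; $a : \mathbb{R}^n \to [0,\infty)$ is a measurable function (not necessarily strictly positive) such that $|a_\alpha(x,\zeta)| \le a(x)|\zeta|$ for almost all $x \in \mathbb{R}^n$, all $\zeta \in \mathbb{R}$ and all $|\alpha| = m$; and $f \in L_{\infty,loc}(\mathbb{R}^n)$ is a non-negative function with $b(x) \ge a^\lambda(x) f(x)$ for almost all $x \in \mathbb{R}^n$ (where $f = 0$, $f^{-1/(\lambda-1)} = \infty$). $B_r$ denotes the open ball in $\mathbb{R}^n$ of radius $r>0$ centered at the origin. A function $u$ is called a solution of the inequality if $b(x)|u|^\lambda \in L_{1,loc}(\mathbb{R}^n)$, $a_\alpha(x,u) \in L_{1,loc}(\mathbb{R}^n)$ for all $|\alpha| = m$, and $$\int_{\mathbb{R}^n} \sum_{|\alpha|=m} a_\alpha(x,u)\, \partial^\alpha \varphi \, dx \ge \int_{\mathbb{R}^n} b(x)|u|^\lambda \varphi\, dx$$ for every non-negative $\varphi \in C_0^\infty(\mathbb{R}^n)$. *)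

theory Defs
  imports "HOL-Analysis.Analysis"
begin

definition partial :: "'n::finite \<Rightarrow> (real^'n \<Rightarrow> real) \<Rightarrow> real^'n \<Rightarrow> real" where
  "partial i g x = deriv (\<lambda>t. g (x + t *\<^sub>R axis i 1)) 0"

fun pderivs :: "'n::finite list \<Rightarrow> (real^'n \<Rightarrow> real) \<Rightarrow> real^'n \<Rightarrow> real" where
  "pderivs [] g = g"
| "pderivs (i # is) g = partial i (pderivs is g)"

text \<open>A fixed enumeration of the coordinate indices (order is irrelevant for smooth functions).\<close>
definition coord_list :: "'n::finite list" where
  "coord_list = (SOME xs. distinct xs \<and> set xs = UNIV)"

definition Dalpha :: "('n::finite \<Rightarrow> nat) \<Rightarrow> (real^'n \<Rightarrow> real) \<Rightarrow> real^'n \<Rightarrow> real" where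
  "Dalpha \<alpha> g = foldr (\<lambda>i h. (partial i ^^ \<alpha> i) h) coord_list g"

definition multi_indices :: "nat \<Rightarrow> ('n::finite \<Rightarrow> nat) set" where
  "multi_indices m = {\<alpha>. sum \<alpha> UNIV = m}"

definition C0_infty :: "(real^'n::finite \<Rightarrow> real) \<Rightarrow> bool" where
  "C0_infty \<phi> \<longleftrightarrow>
     (\<forall>is. continuous_on UNIV (pderivs is \<phi>)) \<and>
     (\<forall>is i x. (\<lambda>t. pderivs is \<phi> (x + t *\<^sub>R axis i 1)) field_differentiable (at 0)) \<and>
     compact (closure {x. \<phi> x \<noteq> 0})"

definition locally_integrable :: "(real^'n::finite \<Rightarrow> real) \<Rightarrow> bool" where
  "locally_integrable g \<longleftrightarrow> (\<forall>r>0. set_integrable lebesgue (ball 0 r) g)"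

definition L_infty_loc :: "(real^'n::finite \<Rightarrow> real) \<Rightarrow> bool" where
  "L_infty_loc g \<longleftrightarrow> g \<in> borel_measurable lebesgue \<and>
     (\<forall>r>0. \<exists>C. AE x in lebesgue. x \<in> ball 0 r \<longrightarrow> \<bar>g x\<bar> \<le> C)"

text \<open>Solution of  sum_{|alpha|=m} (-1)^m d^alpha a_alpha(x,u) >= b |u|^lambda  in the weak sense.\<close>
definition is_solution ::
  "nat \<Rightarrow> real \<Rightarrow> (('n::finite \<Rightarrow> nat) \<Rightarrow> real^'n \<Rightarrow> real \<Rightarrow> real) \<Rightarrow> (real^'n \<Rightarrow> real)
   \<Rightarrow> (real^'n \<Rightarrow> real) \<Rightarrow> bool" where
  "is_solution m lam A b u \<longleftrightarrow>
     locally_integrable (\<lambda>x. b x * \<bar>u x\<bar> powr lam) \<and>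
     (\<forall>\<alpha>\<in>multi_indices m. locally_integrable (\<lambda>x. A \<alpha> x (u x))) \<and>
     (\<forall>\<phi>. C0_infty \<phi> \<and> (\<forall>x. \<phi> x \<ge> 0) \<longrightarrow>
        (\<integral>x. (\<Sum>\<alpha>\<in>multi_indices m. A \<alpha> x (u x) * Dalpha \<alpha> \<phi> x) \<partial>lebesgue)
          \<ge> (\<integral>x. b x * \<bar>u x\<bar> powr lam * \<phi> x \<partial>lebesgue))"

definition fpow :: "real \<Rightarrow> (real^'n::finite \<Rightarrow> real) \<Rightarrow> real^'n \<Rightarrow> ennreal" where
  "fpow lam f x = (if f x = 0 then \<infinity> else ennreal (f x powr (- 1 / (lam - 1))))"

definition qfun :: "real \<Rightarrow> real \<Rightarrow> (real^'n::finite \<Rightarrow> real) \<Rightarrow> real \<Rightarrow> real" where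
  "qfun lam \<sigma> f r =
     (let I = (\<integral>\<^sup>+ x \<in> ball 0 (\<sigma> * r) - ball 0 (r / \<sigma>). fpow lam f x \<partial>lebesgue)
      in if I = \<infinity> then 0 else (enn2real I / r ^ CARD('n)) powr (1 - lam))"

end

theory Submission
  imports Defs
begin

text \<open>Write \<open>w = b |u|^lam\<close> and let \<open>energy R\<close> be the integral of \<open>w\<close> over the ball of radius \<open>R\<close>.
  Test the inequality with a rescaled cutoff \<open>\<Phi>(x/r)\<close> that is constant on \<open>|x| < r/\<sigma>\<close>, vanishes for
  \<open>|x| \<ge> \<sigma> r\<close>, and satisfies \<open>|D\<^sup>\<alpha> \<Phi>| \<le> C \<Phi>^(1/lam)\<close> for \<open>|\<alpha>| = m\<close>. Hoelder's inequality on the annulus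
  gives \<open>G^lam \<le> C r^(-m lam) F^(lam-1) \<Delta>\<close>, where \<open>G\<close> and \<open>\<Delta>\<close> are the integrals of \<open>w \<Phi>(x/r)\<close> over the whole
  space and over the annulus, and \<open>F\<close> is the integral of \<open>f^(-1/(lam-1))\<close> over the annulus. As \<open>\<Delta>\<close> is at
  most both \<open>G\<close> and \<open>energy (\<sigma> r) - energy (r/\<sigma>)\<close>, the integrand \<open>h\<close> of the divergent integral satisfies
  \<open>r h(r) \<le> C (energy (r/\<sigma>)^(1-lam) - energy (\<sigma> r)^(1-lam))\<close> once the energy is positive. Over the scales
  \<open>\<sigma>^k\<close> the right-hand side telescopes, so the integral would converge: the energy must vanish.\<close>

section \<open>Smooth functions of several variables\<close>

text \<open>The class C^k, described through partial derivatives along the axes. Recursion on the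
  order instead of on lists of directions lets closure under products, composition and scaling go
  through by induction on \<open>k\<close> with the function arbitrary, without expanding a Leibniz
  formula.\<close>

fun ck :: "nat \<Rightarrow> (real^'n::finite \<Rightarrow> real) \<Rightarrow> bool" where
  "ck 0 g \<longleftrightarrow> continuous_on UNIV g"
| "ck (Suc k) g \<longleftrightarrow> continuous_on UNIV g \<and>
     (\<forall>i x. (\<lambda>t. g (x + t *\<^sub>R axis i 1)) field_differentiable (at 0)) \<and> (\<forall>i. ck k (partial i g))"

definition smooth :: "(real^'n::finite \<Rightarrow> real) \<Rightarrow> bool" where
  "smooth g \<longleftrightarrow> (\<forall>k. ck k g)"

lemma ck_continuous: "ck k g \<Longrightarrow> continuous_on UNIV g"
  by (cases k) auto

lemma ck_has_partial:
  "ck (Suc k) g \<Longrightarrow> ((\<lambda>t. g (x + t *\<^sub>R axis i 1)) has_field_derivative partial i g x) (at 0)"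
  by (simp add: partial_def DERIV_deriv_iff_field_differentiable)

lemma partial_eqI:
  "(\<And>x. ((\<lambda>t. g (x + t *\<^sub>R axis i 1)) has_field_derivative g' x) (at 0)) \<Longrightarrow> partial i g = g'"
  by (auto simp: partial_def fun_eq_iff intro: DERIV_imp_deriv)

lemma ck_SucI:
  assumes "continuous_on UNIV g"
    and "\<And>i x. ((\<lambda>t. g (x + t *\<^sub>R axis i 1)) has_field_derivative g' i x) (at 0)"
    and "\<And>i. ck k (g' i)"
  shows "ck (Suc k) g"
proof -
  have "partial i g = g' i" for i
    by (rule partial_eqI[OF assms(2)])
  then show ?thesis using assms by (auto simp: field_differentiable_def)
qed

lemma ck_Suc_imp: "ck (Suc k) g \<Longrightarrow> ck k g"
  by (induction k arbitrary: g) auto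

lemma ck_const [simp]: "ck k (\<lambda>x. c)"
proof (induction k arbitrary: c)
  case (Suc k)
  show ?case
    by (rule ck_SucI[where g' = "\<lambda>i x. 0"]) (use Suc in auto)
qed auto

lemma ck_add: "ck k f \<Longrightarrow> ck k g \<Longrightarrow> ck k (\<lambda>x. f x + g x)"
proof (induction k arbitrary: f g)
  case (Suc k)
  show ?case
  proof (rule ck_SucI[where g' = "\<lambda>i x. partial i f x + partial i g x"])
    show "ck k (\<lambda>x. partial i f x + partial i g x)" for i
      using Suc.prems by (intro Suc.IH) auto
  next
    show "continuous_on UNIV (\<lambda>x. f x + g x)"
      using Suc.prems by (auto intro!: continuous_intros)
  qed (intro DERIV_add ck_has_partial[OF Suc.prems(1)] ck_has_partial[OF Suc.prems(2)])
qed (auto intro!: continuous_intros)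

lemma ck_mult: "ck k f \<Longrightarrow> ck k g \<Longrightarrow> ck k (\<lambda>x. f x * g x)"
proof (induction k arbitrary: f g)
  case (Suc k)
  show ?case
  proof (rule ck_SucI[where g' = "\<lambda>i x. partial i f x * g x + partial i g x * f x"])
    fix i x
    show "((\<lambda>t. f (x + t *\<^sub>R axis i 1) * g (x + t *\<^sub>R axis i 1)) has_field_derivative
            partial i f x * g x + partial i g x * f x) (at 0)"
      using DERIV_mult[OF ck_has_partial[OF Suc.prems(1), of x i] ck_has_partial[OF Suc.prems(2), of x i]]
      by simp
  next
    fix i
    show "ck k (\<lambda>x. partial i f x * g x + partial i g x * f x)"
      using Suc.prems by (intro ck_add Suc.IH ck_Suc_imp[OF Suc.prems(1)] ck_Suc_imp[OF Suc.prems(2)]) auto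
  qed (use Suc.prems in \<open>auto intro!: continuous_intros\<close>)
qed (auto intro!: continuous_intros)

text \<open>\<open>H\<close> lists the successive derivatives of the outer function. The chain rule
  leads from \<open>H j\<close> to \<open>H (Suc j)\<close>, so the induction on \<open>k\<close>
  closes once \<open>j\<close> is arbitrary.\<close>

lemma ck_compose:
  fixes H :: "nat \<Rightarrow> real \<Rightarrow> real"
  assumes H: "\<And>j t. (H j has_field_derivative H (Suc j) t) (at t)"
  shows "ck k g \<Longrightarrow> ck k (\<lambda>x. H j (g x))"
proof (induction k arbitrary: j)
  case (Suc k)
  have cont: "continuous_on UNIV (H j)" for j
    by (intro continuous_at_imp_continuous_on ballI DERIV_isCont[OF H])
  show ?case
  proof (rule ck_SucI[where g' = "\<lambda>i x. H (Suc j) (g x) * partial i g x"])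
    show "continuous_on UNIV (\<lambda>x. H j (g x))"
      by (rule continuous_on_compose2[OF cont ck_continuous[OF Suc.prems]]) auto
    fix i x
    show "((\<lambda>t. H j (g (x + t *\<^sub>R axis i 1))) has_field_derivative H (Suc j) (g x) * partial i g x) (at 0)"
      using DERIV_chain2[OF H ck_has_partial[OF Suc.prems, of x i], of j] by simp
  next
    fix i
    show "ck k (\<lambda>x. H (Suc j) (g x) * partial i g x)"
      using Suc.prems by (intro ck_mult Suc.IH ck_Suc_imp[OF Suc.prems]) auto
  qed
next
  case 0
  have "continuous_on UNIV (H j)"
    by (intro continuous_at_imp_continuous_on ballI DERIV_isCont[OF H])
  then show ?case using 0 by (auto intro: continuous_on_compose2)
qed

lemma has_partial_scale:
  assumes "((\<lambda>t. g (c *\<^sub>R x + t *\<^sub>R axis i 1)) has_field_derivative D) (at 0)"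
  shows "((\<lambda>t. g (c *\<^sub>R (x + t *\<^sub>R axis i 1))) has_field_derivative c * D) (at 0)"
proof -
  have "((\<lambda>t. c * t) has_field_derivative c) (at 0)"
    by (auto intro!: derivative_eq_intros)
  from DERIV_chain2[OF _ this, of "\<lambda>t. g (c *\<^sub>R x + t *\<^sub>R axis i 1)" D] assms
  show ?thesis by (simp add: scaleR_add_right mult.commute)
qed

lemma continuous_on_scale:
  "continuous_on UNIV g \<Longrightarrow> continuous_on UNIV (\<lambda>x::real^'n::finite. g (c *\<^sub>R x) :: real)"
  by (rule continuous_on_compose2[of UNIV g]) (auto intro!: continuous_intros)

lemma ck_scale: "ck k g \<Longrightarrow> ck k (\<lambda>x. g (c *\<^sub>R x))"
proof (induction k arbitrary: g)
  case 0
  then show ?case by (simp add: continuous_on_scale)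
next
  case (Suc k)
  show ?case
  proof (rule ck_SucI[where g' = "\<lambda>i x. c * partial i g (c *\<^sub>R x)"])
    show "continuous_on UNIV (\<lambda>x. g (c *\<^sub>R x))"
      using Suc.prems by (simp add: continuous_on_scale)
    show "ck k (\<lambda>x. c * partial i g (c *\<^sub>R x))" for i
      using Suc.prems by (intro ck_mult[OF ck_const Suc.IH]) auto
  qed (intro has_partial_scale ck_has_partial[OF Suc.prems])
qed

lemma ck_component: "ck k (\<lambda>x. x $ i)"
proof (cases k)
  case (Suc l)
  have "((\<lambda>t. (x + t *\<^sub>R axis j 1) $ i) has_field_derivative axis j 1 $ i) (at 0)" for x and j
    by (auto intro!: derivative_eq_intros)
  then show ?thesis unfolding Suc
    by (intro ck_SucI[where g' = "\<lambda>j x. axis j 1 $ i"]) (auto intro!: continuous_intros)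
qed (auto intro!: continuous_intros)

lemma ck_sum: "finite I \<Longrightarrow> (\<And>i. i \<in> I \<Longrightarrow> ck k (g i)) \<Longrightarrow> ck k (\<lambda>x. \<Sum>i\<in>I. g i x)"
  by (induction I rule: finite_induct) (auto intro!: ck_add)

lemma smooth_partial: "smooth g \<Longrightarrow> smooth (partial i g)"
  unfolding smooth_def by (metis ck.simps(2))

lemma smooth_pderivs: "smooth g \<Longrightarrow> smooth (pderivs is g)"
  by (induction "is") (auto intro: smooth_partial)

lemma smooth_continuous: "smooth g \<Longrightarrow> continuous_on UNIV g"
  unfolding smooth_def using ck_continuous by blast

lemma smooth_has_partial:
  "smooth g \<Longrightarrow> ((\<lambda>t. g (x + t *\<^sub>R axis i 1)) has_field_derivative partial i g x) (at 0)"
  unfolding smooth_def using ck_has_partial by blast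

lemma smooth_const [simp]: "smooth (\<lambda>x. c)"
  by (simp add: smooth_def)

lemma smooth_add: "smooth f \<Longrightarrow> smooth g \<Longrightarrow> smooth (\<lambda>x. f x + g x)"
  and smooth_mult: "smooth f \<Longrightarrow> smooth g \<Longrightarrow> smooth (\<lambda>x. f x * g x)"
  and smooth_scale: "smooth g \<Longrightarrow> smooth (\<lambda>x. g (c *\<^sub>R x))"
  by (auto simp: smooth_def intro: ck_add ck_mult ck_scale)

lemma smooth_compose:
  fixes H :: "nat \<Rightarrow> real \<Rightarrow> real"
  assumes "\<And>j t. (H j has_field_derivative H (Suc j) t) (at t)" "smooth g"
  shows "smooth (\<lambda>x. H j (g x))"
  using assms by (auto simp: smooth_def intro: ck_compose)

lemma smooth_power: "smooth g \<Longrightarrow> smooth (\<lambda>x. g x ^ p)"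
  by (induction p) (auto intro: smooth_mult)

lemma smooth_norm_squared: "smooth (\<lambda>x. (norm x)\<^sup>2)"
  unfolding power2_norm_eq_inner inner_vec_def inner_real_def smooth_def
  by (intro allI ck_sum ck_mult ck_component) auto

lemma smooth_imp_C0_infty:
  assumes "smooth g" "\<And>x. norm x \<ge> R \<Longrightarrow> g x = 0"
  shows "C0_infty g"
proof -
  have "{x. g x \<noteq> 0} \<subseteq> ball 0 R"
    using assms(2) by (auto simp: dist_norm not_le[symmetric])
  then have "compact (closure {x. g x \<noteq> 0})"
    using bounded_subset[OF bounded_ball] by (auto simp: compact_closure)
  then show ?thesis
    unfolding C0_infty_def using smooth_pderivs[OF assms(1)]
    by (auto intro: smooth_continuous simp: field_differentiable_def dest: smooth_has_partial)
qed

section \<open>Iterated partial derivatives: scaling, locality, powers, multi-indices\<close>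

lemma pderivs_scale:
  assumes "smooth g"
  shows "pderivs is (\<lambda>x. g (c *\<^sub>R x)) = (\<lambda>x. c ^ length is * pderivs is g (c *\<^sub>R x))"
proof (induction "is")
  case (Cons i "is")
  have "partial i (\<lambda>x. c ^ length is * pderivs is g (c *\<^sub>R x)) =
        (\<lambda>x. c ^ length is * (c * partial i (pderivs is g) (c *\<^sub>R x)))"
    by (intro partial_eqI DERIV_cmult has_partial_scale smooth_has_partial smooth_pderivs assms)
  then show ?case
    by (simp add: Cons.IH mult_ac)
qed auto

lemma partial_const_on_open:
  assumes "open U" "\<And>x. x \<in> U \<Longrightarrow> g x = c" "x \<in> U"
  shows "partial i g x = 0"
proof -
  have "((\<lambda>t::real. x + t *\<^sub>R axis i 1) \<longlongrightarrow> x + 0 *\<^sub>R axis i 1) (nhds 0)"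
    by (intro tendsto_intros filterlim_ident)
  then have "\<forall>\<^sub>F t in nhds 0. x + t *\<^sub>R axis i 1 \<in> U"
    using topological_tendstoD[OF _ assms(1)] assms(3) by fastforce
  then have "\<forall>\<^sub>F t in nhds 0. g (x + t *\<^sub>R axis i 1) = c"
    by (rule eventually_mono) (use assms(2) in auto)
  then have "deriv (\<lambda>t. g (x + t *\<^sub>R axis i 1)) 0 = deriv (\<lambda>t. c) 0"
    by (intro deriv_cong_ev) auto
  then show ?thesis by (simp add: partial_def)
qed

text \<open>Openness makes the innermost derivative 0 on all of \<open>U\<close>; each further one
  differentiates a function that is constantly 0 there.\<close>

lemma pderivs_const_on_open:
  assumes "open U" "\<And>x. x \<in> U \<Longrightarrow> g x = c" "is \<noteq> []" "x \<in> U"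
  shows "pderivs is g x = 0"
  using assms(3,4)
proof (induction "is" arbitrary: x)
  case (Cons i "is")
  show ?case
  proof (cases "is = []")
    case True
    then show ?thesis using partial_const_on_open[OF assms(1,2)] Cons by auto
  next
    case False
    then show ?thesis using partial_const_on_open[OF assms(1) Cons.IH] Cons by auto
  qed
qed auto

text \<open>Each differentiation costs one factor \<psi> and leaves a smooth cofactor. Thus
  derivatives of a high power of \<psi> still decay like a power of \<psi> at the edge of its
  support.\<close>

lemma pderivs_power:
  assumes "smooth \<psi>" "length is \<le> p"
  shows "\<exists>g. smooth g \<and> pderivs is (\<lambda>x. \<psi> x ^ p) = (\<lambda>x. \<psi> x ^ (p - length is) * g x)"
  using assms(2)
proof (induction "is")
  case Nil
  show ?case by (auto intro!: exI[of _ "\<lambda>x. 1"])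
next
  case (Cons i "is")
  then obtain g where g: "smooth g" "pderivs is (\<lambda>x. \<psi> x ^ p) = (\<lambda>x. \<psi> x ^ (p - length is) * g x)"
    by auto
  define q where "q = p - length (i # is)"
  have q: "p - length is = Suc q" using Cons.prems by (auto simp: q_def)
  define g' where "g' = (\<lambda>x. real (Suc q) * (partial i \<psi> x * g x) + \<psi> x * partial i g x)"
  have "((\<lambda>t. \<psi> (x + t *\<^sub>R axis i 1) ^ Suc q * g (x + t *\<^sub>R axis i 1)) has_field_derivative
          \<psi> x ^ q * g' x) (at 0)" for x
    using DERIV_mult[OF DERIV_power[OF smooth_has_partial[OF assms(1), of x i], of "Suc q"]
        smooth_has_partial[OF g(1), of x i]]
    by (rule DERIV_cong) (simp add: g'_def algebra_simps)
  then have "partial i (\<lambda>x. \<psi> x ^ Suc q * g x) = (\<lambda>x. \<psi> x ^ q * g' x)"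
    by (rule partial_eqI)
  moreover have "smooth g'"
    unfolding g'_def by (intro smooth_add smooth_mult smooth_partial assms(1) g(1) smooth_const)
  ultimately show ?case
    unfolding q_def[symmetric] by (auto simp: g(2) q simp del: power_Suc)
qed

text \<open>One list serves all \<open>g\<close>: each coordinate \<open>i\<close> is repeated
  \<open>\<alpha> i\<close> times, in the order of \<open>coord_list\<close>. As this is the order
  built into \<open>Dalpha\<close>, no partial derivatives have to be commuted.\<close>

lemma Dalpha_eq_pderivs:
  fixes \<alpha> :: "'n::finite \<Rightarrow> nat"
  shows "\<exists>is. length is = sum \<alpha> UNIV \<and> (\<forall>g. Dalpha \<alpha> g = pderivs is g)"
proof -
  have step: "(partial i ^^ k) (pderivs is g) = pderivs (replicate k i @ is) g" for i k "is" and g :: "real^'n \<Rightarrow> real"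
    by (induction k) auto
  define D where "D xs = concat (map (\<lambda>i. replicate (\<alpha> i) i) xs)" for xs
  have D: "foldr (\<lambda>i h. (partial i ^^ \<alpha> i) h) xs g = pderivs (D xs) g" for xs and g :: "real^'n \<Rightarrow> real"
    unfolding D_def by (induction xs) (simp_all add: step)
  have len: "length (D xs) = sum_list (map \<alpha> xs)" for xs
    unfolding D_def by (induction xs) auto
  have "\<exists>xs :: 'n list. distinct xs \<and> set xs = UNIV"
    using finite_distinct_list[of "UNIV :: 'n set"] by auto
  then have coord: "distinct (coord_list :: 'n list) \<and> set (coord_list :: 'n list) = UNIV"
    unfolding coord_list_def by (rule someI_ex)
  have "length (D coord_list) = sum \<alpha> UNIV"
    using coord unfolding len by (simp add: sum_list_distinct_conv_sum_set)
  moreover have "\<forall>g. Dalpha \<alpha> g = pderivs (D coord_list) g"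
    by (simp add: Dalpha_def D)
  ultimately show ?thesis by blast
qed

section \<open>A smooth cutoff dominating its derivatives of order m\<close>

text \<open>The polynomial parameter makes the family closed under differentiation;
  \<open>flat 1\<close> is the classical smooth function that is flat at 0.\<close>

definition flat :: "real poly \<Rightarrow> real \<Rightarrow> real" where
  "flat p t = (if t > 0 then poly p (1 / t) * exp (- (1 / t)) else 0)"

lemma poly_times_exp_tendsto_0: "((\<lambda>s. poly p s * exp (- s)) \<longlongrightarrow> (0::real)) at_top"
proof -
  \<comment> \<open>The factor s^k absorbs the variable that \<open>pCons\<close> splits off, so
    that the induction on the polynomial closes.\<close>
  have "((\<lambda>s. s ^ k * (poly p s * exp (- s))) \<longlongrightarrow> (0::real)) at_top" for k
  proof (induction p arbitrary: k)
    case (pCons c p)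
    have "((\<lambda>s. c * (s ^ k / exp s) + s ^ Suc k * (poly p s * exp (- s))) \<longlongrightarrow> c * 0 + 0) at_top"
      by (intro tendsto_intros tendsto_power_div_exp_0 pCons.IH)
    then show ?case by (simp add: algebra_simps exp_minus divide_inverse)
  qed auto
  from this[of 0] show ?thesis by simp
qed

text \<open>With s = 1/t one has ds/dt = -s^2, and p e^(-s) has the s-derivative (p' - p) e^(-s);
  this explains the polynomial. At t = 0 the right difference quotient is s p(s) e^(-s) with s
  tending to infinity, so it tends to 0.\<close>

lemma flat_has_derivative:
  "(flat p has_field_derivative flat ([:0, 0, 1:] * (p - pderiv p)) t) (at t)"
proof -
  consider "t > 0" | "t < 0" | "t = 0" by linarith
  then show ?thesis
  proof cases
    case 1
    have "((\<lambda>t. poly p (1 / t) * exp (- (1 / t))) has_field_derivative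
            flat ([:0, 0, 1:] * (p - pderiv p)) t) (at t)"
    proof -
      have "((\<lambda>t. 1 / t) has_field_derivative - (1 / t)\<^sup>2) (at t)"
        using 1 by (auto intro!: derivative_eq_intros simp: power2_eq_square)
      from DERIV_mult[OF DERIV_chain2[OF poly_DERIV this] DERIV_chain2[OF DERIV_exp DERIV_minus[OF this]], of p]
      show ?thesis
        by (rule DERIV_cong) (use 1 in \<open>simp add: flat_def power2_eq_square algebra_simps\<close>)
    qed
    then show ?thesis
      by (rule has_field_derivative_transform_within_open[of _ _ _ "{0<..}"])
        (use 1 in \<open>auto simp: flat_def\<close>)
  next
    case 2
    have "((\<lambda>t. 0) has_field_derivative flat ([:0, 0, 1:] * (p - pderiv p)) t) (at t)"
      using 2 by (auto simp: flat_def)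
    then show ?thesis
      by (rule has_field_derivative_transform_within_open[of _ _ _ "{..<0}"])
        (use 2 in \<open>auto simp: flat_def\<close>)
  next
    case 3
    have "((\<lambda>h. poly ([:0, 1:] * p) (inverse h) * exp (- inverse h)) \<longlongrightarrow> (0::real)) (at_right 0)"
      by (rule filterlim_compose[OF poly_times_exp_tendsto_0 filterlim_inverse_at_top_right])
    moreover have "\<forall>\<^sub>F h in at_right 0. poly ([:0, 1:] * p) (inverse h) * exp (- inverse h) = flat p h / h"
      by (auto simp: eventually_at_filter flat_def field_simps intro!: always_eventually)
    ultimately have "((\<lambda>h. flat p h / h) \<longlongrightarrow> 0) (at_right 0)"
      by (simp add: filterlim_cong)
    moreover have "((\<lambda>h. flat p h / h) \<longlongrightarrow> 0) (at_left 0)"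
      by (rule tendsto_eventually) (auto simp: eventually_at_filter flat_def)
    ultimately have "((\<lambda>h. flat p h / h) \<longlongrightarrow> 0) (at 0)"
      by (simp add: filterlim_at_split)
    then show ?thesis
      using 3 by (simp add: has_field_derivative_iff flat_def)
  qed
qed

lemma smooth_flat: assumes "smooth g" shows "smooth (\<lambda>x. flat p (g x))"
proof -
  define H where "H j = flat (((\<lambda>p. [:0, 0, 1:] * (p - pderiv p)) ^^ j) p)" for j
  have "smooth (\<lambda>x. H 0 (g x))"
    using flat_has_derivative by (intro smooth_compose[OF _ assms]) (simp only: H_def funpow.simps o_apply)
  then show ?thesis by (simp add: H_def)
qed

lemma flat_1: "flat 1 t = (if t > 0 then exp (- (1 / t)) else 0)"
  by (simp add: flat_def)

lemma flat_1_bounds: "0 \<le> flat 1 t" "flat 1 t \<le> 1"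
  by (auto simp: flat_1)

lemma flat_1_pos: "t > 0 \<Longrightarrow> flat 1 t > 0"
  by (simp add: flat_1)

lemma flat_1_mono: "s \<le> t \<Longrightarrow> flat 1 s \<le> flat 1 t"
  by (auto simp: flat_1 frac_le)

text \<open>The function \<open>flat 1\<close> is applied twice so that the bump is exactly constant on the inner ball
  without dividing by anything; taking a power \<open>p\<close> with \<open>p - m \<ge> p / lam\<close> makes the derivatives of
  order \<open>m\<close> small compared with the cutoff itself.\<close>

lemma cutoff_exists:
  fixes \<sigma> lam :: real
  assumes "\<sigma> > 1" "lam > 1" "m \<ge> 1"
  obtains \<Phi> :: "real^'n::finite \<Rightarrow> real" and \<delta> C :: real
  where "smooth \<Phi>" "\<delta> > 0" "C > 0" "\<And>x. 0 \<le> \<Phi> x" "\<And>x. \<Phi> x \<le> 1"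
    "\<And>x. norm x < 1 / \<sigma> \<Longrightarrow> \<Phi> x = \<delta>" "\<And>x. norm x \<ge> \<sigma> \<Longrightarrow> \<Phi> x = 0"
    "\<And>is x. length is = m \<Longrightarrow> norm x < 1 / \<sigma> \<or> norm x \<ge> \<sigma> \<Longrightarrow> pderivs is \<Phi> x = 0"
    "\<And>is x. length is = m \<Longrightarrow> \<bar>pderivs is \<Phi> x\<bar> \<le> C * \<Phi> x powr (1 / lam)"
proof -
  \<comment> \<open>T is the value of |x|^2 - 1/\<sigma>^2 at |x| = \<sigma>. The argument of the
    outer \<open>flat 1\<close> below is therefore nonpositive for |x| \<ge> \<sigma> and equal to
    \<open>flat 1 T\<close> for |x| < 1/\<sigma>.\<close>
  define T where "T = \<sigma>\<^sup>2 - (1 / \<sigma>)\<^sup>2"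
  define \<psi> :: "real^'n \<Rightarrow> real" where
    "\<psi> x = flat 1 (flat 1 T + (- 1) * flat 1 ((norm x)\<^sup>2 + - (1 / \<sigma>)\<^sup>2))" for x
  have sm: "smooth \<psi>"
    unfolding \<psi>_def[abs_def] by (intro smooth_flat smooth_add smooth_mult smooth_const smooth_norm_squared)
  have \<psi>01: "0 \<le> \<psi> x" "\<psi> x \<le> 1" for x
    by (simp_all add: \<psi>_def flat_1_bounds)
  have "1 / \<sigma> < 1" using assms(1) by simp
  also have "1 < \<sigma>" by (fact assms(1))
  finally have "(1 / \<sigma>)\<^sup>2 < \<sigma>\<^sup>2" using assms(1) by (intro power_strict_mono) auto
  then have T: "T > 0" by (simp add: T_def)
  have inner: "\<psi> x = flat 1 (flat 1 T)" if "norm x < 1 / \<sigma>" for x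
  proof -
    have "(norm x)\<^sup>2 \<le> (1 / \<sigma>)\<^sup>2" using that by (intro power_mono) auto
    then have "flat 1 ((norm x)\<^sup>2 + - (1 / \<sigma>)\<^sup>2) = 0" by (simp add: flat_1)
    then show ?thesis by (simp only: \<psi>_def) simp
  qed
  have outer: "\<psi> x = 0" if "norm x \<ge> \<sigma>" for x
  proof -
    have "\<sigma>\<^sup>2 \<le> (norm x)\<^sup>2" using that assms(1) by (intro power_mono) auto
    then have "flat 1 T \<le> flat 1 ((norm x)\<^sup>2 + - (1 / \<sigma>)\<^sup>2)"
      by (intro flat_1_mono) (simp add: T_def)
    then show ?thesis unfolding \<psi>_def by (subst flat_1) auto
  qed
  \<comment> \<open>The bound m/(1 - 1/lam) \<le> p is equivalent to p/lam \<le> p - m. Adding m + 1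
    ensures m < p, so \<psi>^(p - m) vanishes wherever \<psi> does.\<close>
  obtain p0 :: nat where p0: "real m / (1 - 1 / lam) \<le> real p0"
    using real_arch_simple by blast
  define p where "p = p0 + m + 1"
  have "real m / (1 - 1 / lam) \<le> real p" using p0 by (simp add: p_def)
  then have "real m \<le> real p * (1 - 1 / lam)"
    using assms(2) by (simp add: pos_divide_le_eq)
  then have pm: "real p / lam \<le> real (p - m)"
    by (simp add: p_def of_nat_diff algebra_simps add_divide_distrib)
  have pos: "0 < p - m" "m \<le> p" "0 < p" by (auto simp: p_def)
  define \<Phi> where "\<Phi> x = \<psi> x ^ p" for x
  have \<Phi>_smooth: "smooth \<Phi>"
    unfolding \<Phi>_def[abs_def] by (rule smooth_power[OF sm])
  have factor: "\<exists>g. smooth g \<and> (\<forall>x. pderivs is \<Phi> x = \<psi> x ^ (p - m) * g x)" if "length is = m" for "is"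
    using pderivs_power[OF sm, of "is" p] that pos by (auto simp: \<Phi>_def[abs_def])
  have zero: "pderivs is \<Phi> x = 0" if "length is = m" "norm x < 1 / \<sigma> \<or> norm x \<ge> \<sigma>" for "is" x
    using that(2)
  proof
    assume "norm x < 1 / \<sigma>"
    then show ?thesis
      using that(1) assms(3)
      by (intro pderivs_const_on_open[of "ball 0 (1 / \<sigma>)" _ "flat 1 (flat 1 T) ^ p"])
        (auto simp: \<Phi>_def inner)
  next
    assume "norm x \<ge> \<sigma>"
    then show ?thesis using factor[OF that(1)] outer pos by auto
  qed
  have power_le: "\<psi> x ^ (p - m) \<le> \<Phi> x powr (1 / lam)" for x
  proof (cases "\<psi> x = 0")
    case True
    then show ?thesis using pos by (simp add: power_0_left)
  next
    case False
    then have "\<psi> x > 0" using \<psi>01[of x] by simp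
    then have "\<psi> x ^ (p - m) = \<psi> x powr real (p - m)" "\<Phi> x powr (1 / lam) = \<psi> x powr (real p / lam)"
      by (simp_all add: powr_realpow[symmetric] \<Phi>_def powr_powr)
    then show ?thesis
      using powr_mono'[OF pm] \<psi>01[of x] by simp
  qed
  have "\<exists>C. C \<ge> 0 \<and> (\<forall>x. \<bar>pderivs is \<Phi> x\<bar> \<le> C * \<Phi> x powr (1 / lam))" if len: "length is = m" for "is"
  proof -
    obtain g where g: "smooth g" "\<And>x. pderivs is \<Phi> x = \<psi> x ^ (p - m) * g x"
      using factor[OF len] by blast
    have "compact (g ` cball 0 \<sigma>)"
      using continuous_on_subset[OF smooth_continuous[OF g(1)]] by (intro compact_continuous_image) auto
    then have "bounded (g ` cball 0 \<sigma>)"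
      by (rule compact_imp_bounded)
    then obtain B where B: "\<And>x. x \<in> cball 0 \<sigma> \<Longrightarrow> norm (g x) \<le> B"
      unfolding bounded_iff by blast
    have "\<bar>pderivs is \<Phi> x\<bar> \<le> \<bar>B\<bar> * \<Phi> x powr (1 / lam)" for x
    proof (cases "norm x \<ge> \<sigma>")
      case True
      then show ?thesis using zero[OF len, of x] by simp
    next
      case False
      then have "\<bar>g x\<bar> \<le> \<bar>B\<bar>" using B[of x] by simp
      then have "\<psi> x ^ (p - m) * \<bar>g x\<bar> \<le> \<Phi> x powr (1 / lam) * \<bar>B\<bar>"
        using power_le \<psi>01 by (intro mult_mono) auto
      then show ?thesis using g(2) \<psi>01 by (simp add: abs_mult mult.commute)
    qed
    then show ?thesis by (intro exI[of _ "\<bar>B\<bar>"]) auto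
  qed
  then obtain C where C: "\<And>is. length is = m \<Longrightarrow> C is \<ge> 0"
    "\<And>is x. length is = m \<Longrightarrow> \<bar>pderivs is \<Phi> x\<bar> \<le> C is * \<Phi> x powr (1 / lam)"
    by metis
  \<comment> \<open>Only finitely many lists have length m, so the sum of their constants serves all
    of them; the added 1 makes it positive.\<close>
  define L where "L = {is :: 'n list. length is = m}"
  have "finite L" using finite_lists_length_eq[of "UNIV :: 'n set" m] by (simp add: L_def)
  then have C_le: "C is \<le> 1 + sum C L" if "length is = m" for "is"
    using that member_le_sum[of "is" L C] C(1) by (force simp: L_def)
  have bound: "\<bar>pderivs is \<Phi> x\<bar> \<le> (1 + sum C L) * \<Phi> x powr (1 / lam)" if "length is = m" for "is" x
    using C(2)[OF that, of x] mult_right_mono[OF C_le[OF that], of "\<Phi> x powr (1 / lam)"] by simp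
  have "sum C L \<ge> 0" using C(1) by (intro sum_nonneg) (auto simp: L_def)
  then show thesis
    using \<psi>01 T pos inner outer
    by (intro that[of \<Phi> "flat 1 (flat 1 T) ^ p" "1 + sum C L"] \<Phi>_smooth zero bound)
      (auto simp: \<Phi>_def power_le_one flat_1_pos)
qed

section \<open>Elementary inequalities for real powers\<close>

text \<open>Young's inequality without sharp constants. Applied pointwise and optimised in \<open>t\<close> only after
  integration, it replaces Hoelder's inequality and avoids having to prove \<open>u\<close> measurable.\<close>

lemma powr_product_le_sum:
  fixes P y t lam :: real
  assumes "P \<ge> 0" "y > 0" "t > 0" "lam > 1"
  shows "(P / y) powr (1 / lam) \<le> t * P + t powr (- 1 / (lam - 1)) * y powr (- 1 / (lam - 1))"
proof (cases "(P / y) powr (1 / lam) \<le> t * P")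
  case True
  then show ?thesis by (simp add: add_increasing2)
next
  case False
  \<comment> \<open>Here v > t P, so v^lam = P/y < v/(t y). Hence t y v^(lam - 1) < 1, which bounds
    v by the second summand alone.\<close>
  define v where "v = (P / y) powr (1 / lam)"
  have P: "P > 0" and v: "v > 0" "t * P < v" using False assms by (auto simp: v_def not_le less_le)
  have "v powr lam = P / y" using assms P by (simp add: v_def powr_powr)
  then have "t * y * v powr lam < v" using v(2) assms(2) by (simp add: field_simps)
  then have "t * y * v powr (lam - 1) < 1"
    using v(1) by (simp add: powr_diff divide_simps)
  then have "v powr (lam - 1) < 1 / (t * y)"
    using assms by (simp add: field_simps)
  then have "(v powr (lam - 1)) powr (1 / (lam - 1)) < (1 / (t * y)) powr (1 / (lam - 1))"
    using assms by (intro powr_less_mono2) auto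
  then have "v < (1 / (t * y)) powr (1 / (lam - 1))"
    using v(1) assms by (simp add: powr_powr)
  also have "\<dots> = t powr (- 1 / (lam - 1)) * y powr (- 1 / (lam - 1))"
    using assms by (simp add: powr_divide powr_mult powr_minus_divide)
  finally show ?thesis
    using assms by (simp add: v_def add_increasing)
qed

text \<open>Optimising in t recovers Hoelder's inequality G^lam \<le> (2K)^lam F^(lam - 1) D, solved
  here for the power of F that occurs in q.\<close>

lemma optimize_split:
  fixes G D F K lam :: real
  assumes "G > 0" "D \<ge> 0" "F > 0" "K > 0" "lam > 1"
    and split: "\<And>t. t > 0 \<Longrightarrow> G \<le> K * (t * D + t powr (- 1 / (lam - 1)) * F)"
  shows "F powr (1 - lam) \<le> (2 * K / G) powr lam * D"
proof -
  \<comment> \<open>The choice of t divides by the bound on the first term, and D may be 0; a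
    positive E \<ge> D takes its place and is finally lowered to D.\<close>
  have *: "F powr (1 - lam) \<le> (2 * K / G) powr lam * E" if E: "E > 0" "D \<le> E" for E
  proof -
    \<comment> \<open>This t makes K t E equal to G/2, so the other term must carry the remaining
      half of G.\<close>
    define t where "t = G / (2 * K * E)"
    have t: "t > 0" using assms E by (simp add: t_def)
    have "K * t * D \<le> K * t * E" using E t assms by (intro mult_left_mono) auto
    also have "K * t * E = G / 2" using assms E by (simp add: t_def field_simps)
    finally have "G / 2 \<le> K * (t powr (- 1 / (lam - 1)) * F)"
      using split[OF t] by (simp add: algebra_simps)
    then have "G / (2 * K) * t powr (1 / (lam - 1)) \<le> F"
      using assms t by (simp add: powr_minus_divide field_simps)
    then have "F powr (1 - lam) \<le> (G / (2 * K) * t powr (1 / (lam - 1))) powr (1 - lam)"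
      using assms t by (intro powr_mono2') auto
    also have "\<dots> = (G / (2 * K)) powr (1 - lam) * t powr - 1"
    proof -
      have "1 / (lam - 1) * (1 - lam) = - 1" using assms by (simp add: field_simps)
      then have "(t powr (1 / (lam - 1))) powr (1 - lam) = t powr - 1"
        unfolding powr_powr by (rule arg_cong)
      then show ?thesis by (simp only: powr_mult)
    qed
    also have "\<dots> = (2 * K / G) powr (lam - 1) * (2 * K / G * E)"
    proof -
      have "(G / (2 * K)) powr (1 - lam) = (2 * K / G) powr (lam - 1)"
        using assms by (simp add: powr_divide powr_diff field_simps)
      moreover have "t powr - 1 = 2 * K / G * E"
        using t assms E by (simp add: powr_minus_divide t_def)
      ultimately show ?thesis by simp
    qed
    also have "\<dots> = (2 * K / G) powr lam * E"
      using assms by (simp add: powr_diff)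
    finally show ?thesis .
  qed
  define M where "M = (2 * K / G) powr lam"
  have M: "M > 0" using assms by (simp add: M_def)
  show ?thesis
  proof (rule field_le_epsilon)
    fix e :: real assume "e > 0"
    then show "F powr (1 - lam) \<le> (2 * K / G) powr lam * D + e"
      using *[of "D + e / M"] M assms(2) unfolding M_def[symmetric]
      by (simp add: distrib_left add_nonneg_pos)
  qed
qed

text \<open>A discrete form of -d(x^(1-lam)) = (lam - 1) x^(-lam) dx. For y \<le> 2x the mean value
  theorem gives it at the cost of 2^lam. For y > 2x the difference on the right is at least a fixed
  fraction of x^(1-lam), and the second argument of the minimum takes over.\<close>

lemma increment_le_powr_diff:
  fixes x y lam :: real
  assumes "0 < x" "x \<le> y" "lam > 1"
  shows "min ((y - x) * x powr - lam) (x powr (1 - lam))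
    \<le> (2 powr lam / (lam - 1) + 1 / (1 - 2 powr (1 - lam))) * (x powr (1 - lam) - y powr (1 - lam))"
proof -
  define A where "A = 2 powr lam / (lam - 1)"
  define B where "B = 1 / (1 - 2 powr (1 - lam))"
  have "2 powr (1 - lam) < 2 powr (0::real)" using assms by (intro powr_less_mono) auto
  then have q: "2 powr (1 - lam) < (1::real)" by simp
  have AB: "A > 0" "B > 0" using assms q by (auto simp: A_def B_def)
  have d: "0 \<le> x powr (1 - lam) - y powr (1 - lam)"
    using assms by (simp add: powr_mono2')
  have "min ((y - x) * x powr - lam) (x powr (1 - lam)) \<le> A * (x powr (1 - lam) - y powr (1 - lam)) \<or>
        min ((y - x) * x powr - lam) (x powr (1 - lam)) \<le> B * (x powr (1 - lam) - y powr (1 - lam))"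
  proof (cases "y \<le> 2 * x")
    case True
    have "(y - x) * x powr - lam \<le> A * (x powr (1 - lam) - y powr (1 - lam))"
    proof (cases "x = y")
      case False
      then have xy: "x < y" using assms by simp
      have "((\<lambda>z. z powr (1 - lam)) has_real_derivative (1 - lam) * z powr (1 - lam - 1)) (at z)"
        if "x \<le> z" "z \<le> y" for z
        using that assms by (intro has_real_derivative_powr) auto
      from MVT2[OF xy this] obtain z where z: "x < z" "z < y"
        "y powr (1 - lam) - x powr (1 - lam) = (y - x) * ((1 - lam) * z powr (1 - lam - 1))"
        by auto
      have "(2 * x) powr - lam \<le> z powr - lam"
        using z True assms by (intro powr_mono2') auto
      then have "(y - x) * (lam - 1) * (2 * x) powr - lam \<le> (y - x) * (lam - 1) * z powr - lam"
        using assms by (intro mult_left_mono) auto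
      also have "\<dots> = x powr (1 - lam) - y powr (1 - lam)"
        using z(3) by (simp add: algebra_simps)
      finally have "A * ((y - x) * (lam - 1) * (2 * x) powr - lam) \<le> A * (x powr (1 - lam) - y powr (1 - lam))"
        using AB by (intro mult_left_mono) auto
      also have "A * ((y - x) * (lam - 1) * (2 * x) powr - lam) = (y - x) * x powr - lam"
        using assms by (simp add: A_def powr_mult powr_minus_divide)
      finally show ?thesis .
    qed simp
    then show ?thesis by linarith
  next
    case False
    then have "y powr (1 - lam) \<le> (2 * x) powr (1 - lam)"
      using assms by (intro powr_mono2') auto
    then have "(1 - 2 powr (1 - lam)) * x powr (1 - lam) \<le> x powr (1 - lam) - y powr (1 - lam)"
      using assms by (simp add: powr_mult algebra_simps)
    then have "x powr (1 - lam) \<le> B * (x powr (1 - lam) - y powr (1 - lam))"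
      using q by (simp add: B_def field_simps)
    then show ?thesis by linarith
  qed
  then show ?thesis
    using mult_nonneg_nonneg[OF less_imp_le[OF AB(1)] d] mult_nonneg_nonneg[OF less_imp_le[OF AB(2)] d]
    unfolding A_def[symmetric] B_def[symmetric] distrib_right by linarith
qed

section \<open>Growth of the energy of a solution\<close>

text \<open>The hypothesis on b amounts to a \<le> (b/f)^(1/lam). The right-hand side has the form
  to which \<open>powr_product_le_sum\<close> applies, with y = f.\<close>

lemma coefficient_bound:
  fixes a b f s \<phi> lam :: real
  assumes "lam > 1" "a \<ge> 0" "s \<ge> 0" "\<phi> \<ge> 0" "f > 0" "a powr lam * f \<le> b"
  shows "a * s * \<phi> powr (1 / lam) \<le> (b * s powr lam * \<phi> / f) powr (1 / lam)"
proof -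
  have "a * s * \<phi> powr (1 / lam) = (a powr lam * s powr lam * \<phi>) powr (1 / lam)"
    using assms by (simp add: powr_mult powr_powr)
  also have "\<dots> \<le> (b * s powr lam * \<phi> / f) powr (1 / lam)"
  proof (rule powr_mono2)
    have "a powr lam * (s powr lam * \<phi>) \<le> b / f * (s powr lam * \<phi>)"
      using assms by (intro mult_right_mono) (auto simp: pos_le_divide_eq)
    then show "a powr lam * s powr lam * \<phi> \<le> b * s powr lam * \<phi> / f" by (simp add: mult.assoc)
  qed (use assms in auto)
  finally show ?thesis .
qed

text \<open>A non-integrable function has Bochner integral 0, so the bound holds for every g; the
  tested integrand can be estimated without proving it integrable.\<close>

lemma ennreal_integral_le_nn_integral:
  fixes g :: "'a \<Rightarrow> real"
  shows "ennreal (integral\<^sup>L M g) \<le> (\<integral>\<^sup>+x. ennreal \<bar>g x\<bar> \<partial>M)"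
proof (cases "integrable M g")
  case True
  have "ennreal (integral\<^sup>L M g) \<le> ennreal (norm (integral\<^sup>L M g))"
    unfolding real_norm_def by (rule ennreal_leI[OF abs_ge_self])
  also have "\<dots> \<le> (\<integral>\<^sup>+x. ennreal (norm (g x)) \<partial>M)"
    by (rule integral_norm_bound_ennreal[OF True])
  finally show ?thesis unfolding real_norm_def .
qed (simp add: not_integrable_integral_eq)

lemma measurable_fpow:
  assumes [measurable]: "f \<in> borel_measurable lebesgue"
  shows "fpow lam f \<in> borel_measurable lebesgue"
  unfolding fpow_def by measurable

lemma integrable_times_cutoff:
  fixes w \<phi> :: "real^'n::finite \<Rightarrow> real"
  assumes "locally_integrable w" "continuous_on UNIV \<phi>" "\<And>x. \<bar>\<phi> x\<bar> \<le> 1"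
    "\<And>x. norm x \<ge> R \<Longrightarrow> \<phi> x = 0" "R > 0"
  shows "integrable lebesgue (\<lambda>x. w x * \<phi> x)"
proof -
  have w: "integrable lebesgue (\<lambda>x. indicator (ball 0 R) x * w x)"
    using assms(1,5) by (auto simp: locally_integrable_def set_integrable_def)
  have "\<phi> \<in> borel_measurable lebesgue"
    using borel_measurable_continuous_onI[OF assms(2)] by (intro measurable_completion) simp
  then have "(\<lambda>x. indicator (ball 0 R) x * w x * \<phi> x) \<in> borel_measurable lebesgue"
    by (rule borel_measurable_times[OF borel_measurable_integrable[OF w]])
  moreover have "AE x in lebesgue. norm (indicator (ball 0 R) x * w x * \<phi> x)
      \<le> norm (indicator (ball 0 R) x * w x)"
    using assms(3) by (intro AE_I2) (auto simp: abs_mult intro!: mult_left_le)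
  ultimately have "integrable lebesgue (\<lambda>x. indicator (ball 0 R) x * w x * \<phi> x)"
    by (rule Bochner_Integration.integrable_bound[OF w])
  moreover have "indicator (ball 0 R) x * w x * \<phi> x = w x * \<phi> x" for x
    using assms(4)[of x] by (auto simp: indicator_def)
  ultimately show ?thesis by simp
qed

text \<open>A single cutoff \<Phi> is fixed and only rescaled, so \<delta> and C do not depend on
  the radius.\<close>

locale solution_with_cutoff =
  fixes m :: nat and lam \<sigma> \<delta> C :: real
    and A :: "('n::finite \<Rightarrow> nat) \<Rightarrow> real^'n \<Rightarrow> real \<Rightarrow> real"
    and a b f u \<Phi> :: "real^'n \<Rightarrow> real"
  assumes lam: "lam > 1"
    and b_pos: "\<forall>x. b x > 0"
    and a_nonneg: "\<forall>x. a x \<ge> 0"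
    and A_le: "AE x in lebesgue. \<forall>\<alpha>\<in>multi_indices m. \<forall>\<zeta>. \<bar>A \<alpha> x \<zeta>\<bar> \<le> a x * \<bar>\<zeta>\<bar>"
    and f_meas: "f \<in> borel_measurable lebesgue" and f_nonneg: "\<forall>x. f x \<ge> 0"
    and b_ge: "AE x in lebesgue. b x \<ge> a x powr lam * f x"
    and \<sigma>: "\<sigma> > 1"
    and sol: "is_solution m lam A b u"
    and \<Phi>_smooth: "smooth \<Phi>" and C: "C > 0" and \<delta>: "\<delta> > 0"
    and \<Phi>01: "\<And>x. 0 \<le> \<Phi> x" "\<And>x. \<Phi> x \<le> 1"
    and \<Phi>_inner: "\<And>x. norm x < 1 / \<sigma> \<Longrightarrow> \<Phi> x = \<delta>"
    and \<Phi>_outer: "\<And>x. norm x \<ge> \<sigma> \<Longrightarrow> \<Phi> x = 0"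
    and \<Phi>_deriv_0: "\<And>is x. length is = m \<Longrightarrow> norm x < 1 / \<sigma> \<or> norm x \<ge> \<sigma> \<Longrightarrow> pderivs is \<Phi> x = 0"
    and \<Phi>_deriv_le: "\<And>is x. length is = m \<Longrightarrow> \<bar>pderivs is \<Phi> x\<bar> \<le> C * \<Phi> x powr (1 / lam)"
begin

definition w :: "real^'n \<Rightarrow> real" where "w x = b x * \<bar>u x\<bar> powr lam"
definition \<Phi>s :: "real \<Rightarrow> real^'n \<Rightarrow> real" where "\<Phi>s r x = \<Phi> ((1 / r) *\<^sub>R x)"
definition annulus :: "real \<Rightarrow> (real^'n) set" where "annulus r = ball 0 (\<sigma> * r) - ball 0 (r / \<sigma>)"
definition energy :: "real \<Rightarrow> real" where
  "energy R = (\<integral>x. indicator (ball 0 R) x * w x \<partial>lebesgue)"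

lemma w_nonneg: "w x \<ge> 0"
  using b_pos by (simp add: w_def less_imp_le)

lemma w_locally_integrable: "locally_integrable w"
  using sol by (simp add: is_solution_def w_def[abs_def])

lemma integrable_w_ball: "R > 0 \<Longrightarrow> integrable lebesgue (\<lambda>x. indicator (ball 0 R) x * w x)"
  using w_locally_integrable by (auto simp: locally_integrable_def set_integrable_def)

lemma cutoff_scaled:
  assumes "r > 0"
  shows "smooth (\<Phi>s r)" "0 \<le> \<Phi>s r x" "\<Phi>s r x \<le> 1"
    "x \<in> ball 0 (r / \<sigma>) \<Longrightarrow> \<Phi>s r x = \<delta>" "x \<notin> ball 0 (\<sigma> * r) \<Longrightarrow> \<Phi>s r x = 0"
    "norm x \<ge> \<sigma> * r \<Longrightarrow> \<Phi>s r x = 0"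
  using assms \<sigma> \<Phi>01 unfolding \<Phi>s_def[abs_def]
  by (auto intro!: smooth_scale \<Phi>_smooth \<Phi>_inner \<Phi>_outer simp: field_simps not_less)

lemma Dalpha_cutoff_scaled:
  assumes "r > 0" "\<alpha> \<in> multi_indices m"
  shows "x \<notin> annulus r \<Longrightarrow> Dalpha \<alpha> (\<Phi>s r) x = 0"
    "\<bar>Dalpha \<alpha> (\<Phi>s r) x\<bar> \<le> C * (1 / r) ^ m * \<Phi>s r x powr (1 / lam)"
proof -
  obtain "is" where "is": "length is = m" "Dalpha \<alpha> (\<Phi>s r) = pderivs is (\<Phi>s r)"
    using Dalpha_eq_pderivs[of \<alpha>] assms(2) by (auto simp: multi_indices_def)
  have D: "Dalpha \<alpha> (\<Phi>s r) x = (1 / r) ^ m * pderivs is \<Phi> ((1 / r) *\<^sub>R x)"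
  proof -
    have "\<Phi>s r = (\<lambda>x. \<Phi> ((1 / r) *\<^sub>R x))" by (simp add: \<Phi>s_def fun_eq_iff)
    then show ?thesis
      using pderivs_scale[OF \<Phi>_smooth, of "is" "1 / r"] "is" by simp
  qed
  show "Dalpha \<alpha> (\<Phi>s r) x = 0" if "x \<notin> annulus r"
    using that \<Phi>_deriv_0[OF "is"(1), of "(1 / r) *\<^sub>R x"] assms(1) \<sigma>
    unfolding D annulus_def by (auto simp: field_simps not_less)
  show "\<bar>Dalpha \<alpha> (\<Phi>s r) x\<bar> \<le> C * (1 / r) ^ m * \<Phi>s r x powr (1 / lam)"
    using mult_left_mono[OF \<Phi>_deriv_le[OF "is"(1), of "(1 / r) *\<^sub>R x"], of "(1 / r) ^ m"] assms(1)
    unfolding D \<Phi>s_def by (simp add: abs_mult mult_ac)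
qed

text \<open>The added 1 gives positivity without counting multi-indices.\<close>

definition Kc :: real where
  "Kc = (real (card (multi_indices m :: ('n \<Rightarrow> nat) set)) + 1) * C"

lemma Kc_pos: "Kc > 0"
  using C by (simp add: Kc_def add_nonneg_pos)

text \<open>Off the annulus all derivatives of order m vanish. On it, finiteness of the integral of
  \<open>fpow lam f\<close> forces f > 0 almost everywhere, and \<open>coefficient_bound\<close>
  followed by \<open>powr_product_le_sum\<close> applies to each summand.\<close>

lemma integrand_le:
  assumes "r > 0" "t > 0" and fin: "(\<integral>\<^sup>+ x\<in>annulus r. fpow lam f x \<partial>lebesgue) \<noteq> \<infinity>"
  shows "AE x in lebesgue. ennreal \<bar>\<Sum>\<alpha>\<in>multi_indices m. A \<alpha> x (u x) * Dalpha \<alpha> (\<Phi>s r) x\<bar>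
    \<le> ennreal (Kc / r ^ m) * (ennreal (t * (indicator (annulus r) x * (w x * \<Phi>s r x)))
        + ennreal (t powr (- 1 / (lam - 1))) * (fpow lam f x * indicator (annulus r) x))"
proof -
  have meas: "(\<lambda>x. fpow lam f x * indicator (annulus r) x) \<in> borel_measurable lebesgue"
    using measurable_fpow[OF f_meas]
    by (intro borel_measurable_times_ennreal borel_measurable_indicator) (auto simp: annulus_def)
  have "AE x in lebesgue. fpow lam f x * indicator (annulus r) x \<noteq> \<infinity>"
    using nn_integral_PInf_AE[OF meas] fin by simp
  with A_le b_ge show ?thesis
  proof eventually_elim
    case (elim x)
    let ?S = "\<Sum>\<alpha>\<in>multi_indices m. A \<alpha> x (u x) * Dalpha \<alpha> (\<Phi>s r) x"
    show ?case
    proof (cases "x \<in> annulus r")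
      case False
      then show ?thesis using Dalpha_cutoff_scaled(1)[OF assms(1)] by simp
    next
      case True
      then have "f x \<noteq> 0" using elim(3) by (auto simp: fpow_def)
      then have f: "f x > 0" using f_nonneg by (simp add: less_le)
      define V where "V = a x * \<bar>u x\<bar> * \<Phi>s r x powr (1 / lam)"
      define W where "W = t * (w x * \<Phi>s r x) + t powr (- 1 / (lam - 1)) * f x powr (- 1 / (lam - 1))"
      have "V \<le> (w x * \<Phi>s r x / f x) powr (1 / lam)"
        unfolding V_def w_def using a_nonneg cutoff_scaled(2)[OF assms(1)] f elim(2) lam
        by (intro coefficient_bound) auto
      also have "\<dots> \<le> W"
        unfolding W_def using w_nonneg cutoff_scaled(2)[OF assms(1)] f lam assms(2)
        by (intro powr_product_le_sum) auto
      finally have VW: "V \<le> W" .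
      have V0: "V \<ge> 0" using a_nonneg by (simp add: V_def)
      have "norm ?S \<le> real (card (multi_indices m :: ('n \<Rightarrow> nat) set)) * (C * (1 / r) ^ m * V)"
      proof (rule sum_norm_bound)
        fix \<alpha> :: "'n \<Rightarrow> nat" assume \<alpha>: "\<alpha> \<in> multi_indices m"
        have "\<bar>A \<alpha> x (u x)\<bar> * \<bar>Dalpha \<alpha> (\<Phi>s r) x\<bar> \<le>
            (a x * \<bar>u x\<bar>) * (C * (1 / r) ^ m * \<Phi>s r x powr (1 / lam))"
          using elim(1) \<alpha> a_nonneg by (intro mult_mono Dalpha_cutoff_scaled(2)[OF assms(1)]) auto
        then show "norm (A \<alpha> x (u x) * Dalpha \<alpha> (\<Phi>s r) x) \<le> C * (1 / r) ^ m * V"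
          by (simp add: abs_mult V_def mult_ac)
      qed
      also have "\<dots> \<le> (real (card (multi_indices m :: ('n \<Rightarrow> nat) set)) + 1) * (C * (1 / r) ^ m * V)"
        using V0 C assms(1) by (intro mult_right_mono) auto
      also have "\<dots> = Kc / r ^ m * V"
        by (simp add: Kc_def power_divide)
      also have "\<dots> \<le> Kc / r ^ m * W"
        using VW Kc_pos assms(1) by (intro mult_left_mono) auto
      finally have "ennreal \<bar>?S\<bar> \<le> ennreal (Kc / r ^ m * W)"
        by (intro ennreal_leI) simp
      also have "\<dots> = ennreal (Kc / r ^ m) * (ennreal (t * (w x * \<Phi>s r x))
        + ennreal (t powr (- 1 / (lam - 1))) * ennreal (f x powr (- 1 / (lam - 1))))"
        using Kc_pos assms w_nonneg cutoff_scaled(2)[OF assms(1)]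
        unfolding W_def by (subst ennreal_mult) (auto simp: ennreal_mult)
      finally show ?thesis using True f by (simp add: fpow_def)
    qed
  qed
qed

section \<open>The tested inequality in integrated form and the resulting growth estimate\<close>

definition G :: "real \<Rightarrow> real" where "G r = (\<integral>x. w x * \<Phi>s r x \<partial>lebesgue)"
definition \<Delta> :: "real \<Rightarrow> real" where
  "\<Delta> r = (\<integral>x. indicator (annulus r) x * (w x * \<Phi>s r x) \<partial>lebesgue)"
text \<open>\<open>enn2real\<close> sends an infinite integral to 0, so finiteness is tracked
  separately.\<close>

definition F :: "real \<Rightarrow> real" where
  "F r = enn2real (\<integral>\<^sup>+ x\<in>annulus r. fpow lam f x \<partial>lebesgue)"

lemma integrable_w_cutoff:
  assumes "r > 0"
  shows "integrable lebesgue (\<lambda>x. w x * \<Phi>s r x)"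
    "integrable lebesgue (\<lambda>x. indicator (annulus r) x * (w x * \<Phi>s r x))"
proof -
  show int: "integrable lebesgue (\<lambda>x. w x * \<Phi>s r x)"
    using w_locally_integrable cutoff_scaled[OF assms] assms \<sigma>
    by (intro integrable_times_cutoff[of _ _ "\<sigma> * r"] smooth_continuous) (auto simp: abs_le_iff intro: order_trans[of _ 0])
  have "annulus r \<in> sets lebesgue" by (auto simp: annulus_def)
  from integrable_mult_indicator[OF this int]
  show "integrable lebesgue (\<lambda>x. indicator (annulus r) x * (w x * \<Phi>s r x))" by simp
qed

text \<open>\<open>\<Phi>s r\<close> is the test function. The estimate runs in
  \<open>ennreal\<close>, where only the measurable majorant from \<open>integrand_le\<close> has to
  be integrated exactly.\<close>

lemma G_le:
  assumes "r > 0" "t > 0" and fin: "(\<integral>\<^sup>+ x\<in>annulus r. fpow lam f x \<partial>lebesgue) \<noteq> \<infinity>"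
  shows "G r \<le> Kc / r ^ m * (t * \<Delta> r + t powr (- 1 / (lam - 1)) * F r)"
proof -
  let ?I = "\<lambda>x. \<Sum>\<alpha>\<in>multi_indices m. A \<alpha> x (u x) * Dalpha \<alpha> (\<Phi>s r) x"
  have "C0_infty (\<Phi>s r)"
    using cutoff_scaled[OF assms(1)] by (intro smooth_imp_C0_infty[of _ "\<sigma> * r"]) auto
  then have "G r \<le> integral\<^sup>L lebesgue ?I"
    using sol cutoff_scaled(2)[OF assms(1)] unfolding is_solution_def G_def w_def by simp
  then have "ennreal (G r) \<le> ennreal (integral\<^sup>L lebesgue ?I)"
    by (rule ennreal_leI)
  also have "\<dots> \<le> (\<integral>\<^sup>+x. ennreal \<bar>?I x\<bar> \<partial>lebesgue)"
    by (rule ennreal_integral_le_nn_integral)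
  also have "\<dots> \<le> (\<integral>\<^sup>+x. ennreal (Kc / r ^ m) * (ennreal (t * (indicator (annulus r) x * (w x * \<Phi>s r x)))
        + ennreal (t powr (- 1 / (lam - 1))) * (fpow lam f x * indicator (annulus r) x)) \<partial>lebesgue)"
    by (rule nn_integral_mono_AE[OF integrand_le[OF assms]])
  also have "\<dots> = ennreal (Kc / r ^ m) * ((\<integral>\<^sup>+x. ennreal (t * (indicator (annulus r) x * (w x * \<Phi>s r x))) \<partial>lebesgue)
        + ennreal (t powr (- 1 / (lam - 1))) * (\<integral>\<^sup>+ x\<in>annulus r. fpow lam f x \<partial>lebesgue))"
  proof -
    have m1: "(\<lambda>x. ennreal (t * (indicator (annulus r) x * (w x * \<Phi>s r x)))) \<in> borel_measurable lebesgue"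
      by (rule measurable_compose[OF borel_measurable_times[OF borel_measurable_const
          borel_measurable_integrable[OF integrable_w_cutoff(2)[OF assms(1)]]] measurable_ennreal])
    have m2: "(\<lambda>x. fpow lam f x * indicator (annulus r) x) \<in> borel_measurable lebesgue"
      using measurable_fpow[OF f_meas]
      by (intro borel_measurable_times_ennreal borel_measurable_indicator) (auto simp: annulus_def)
    show ?thesis
      using m1 m2 by (simp add: nn_integral_cmult nn_integral_add borel_measurable_times_ennreal)
  qed
  also have "(\<integral>\<^sup>+x. ennreal (t * (indicator (annulus r) x * (w x * \<Phi>s r x))) \<partial>lebesgue) = ennreal (t * \<Delta> r)"
    using integrable_w_cutoff(2)[OF assms(1)] assms w_nonneg cutoff_scaled(2)[OF assms(1)]
    unfolding \<Delta>_def by (subst nn_integral_eq_integral) auto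
  also have "(\<integral>\<^sup>+ x\<in>annulus r. fpow lam f x \<partial>lebesgue) = ennreal (F r)"
    using fin unfolding F_def by (simp add: less_top)
  also have "ennreal (Kc / r ^ m) * (ennreal (t * \<Delta> r) + ennreal (t powr (- 1 / (lam - 1))) * ennreal (F r))
      = ennreal (Kc / r ^ m * (t * \<Delta> r + t powr (- 1 / (lam - 1)) * F r))"
  proof -
    have "\<Delta> r \<ge> 0"
      using w_nonneg cutoff_scaled(2)[OF assms(1)] unfolding \<Delta>_def by (intro Bochner_Integration.integral_nonneg) auto
    moreover have "F r \<ge> 0" by (simp add: F_def)
    ultimately show ?thesis
      using Kc_pos assms by (subst ennreal_mult) (auto simp: ennreal_mult)
  qed
  finally have *: "ennreal (G r) \<le> ennreal (Kc / r ^ m * (t * \<Delta> r + t powr (- 1 / (lam - 1)) * F r))" .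
  have "\<Delta> r \<ge> 0"
    using w_nonneg cutoff_scaled(2)[OF assms(1)] unfolding \<Delta>_def by (intro Bochner_Integration.integral_nonneg) auto
  moreover have "F r \<ge> 0" by (simp add: F_def)
  ultimately show ?thesis
    using * Kc_pos assms by (subst (asm) ennreal_le_iff) auto
qed

text \<open>The two upper bounds on \<Delta> complement each other: the energy increment is good
  when the energy grows slowly, G itself when it grows fast.\<close>

lemma energy_bounds:
  assumes "r > 0"
  shows "\<delta> * energy (r / \<sigma>) \<le> G r" "\<Delta> r \<le> G r" "0 \<le> \<Delta> r"
    "\<Delta> r \<le> energy (\<sigma> * r) - energy (r / \<sigma>)"
proof -
  note [simp] = w_nonneg cutoff_scaled(2,3)[OF assms]
  note int = integrable_w_cutoff[OF assms]
  have sub: "ball 0 (r / \<sigma>) \<subseteq> (ball 0 (\<sigma> * r) :: (real^'n) set)"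
  proof (rule subset_ball)
    have "r / \<sigma> \<le> r" "r \<le> \<sigma> * r" using assms \<sigma> by (auto simp: field_simps)
    then show "r / \<sigma> \<le> \<sigma> * r" by simp
  qed
  have pos: "r / \<sigma> > 0" "\<sigma> * r > 0" using assms \<sigma> by auto
  have "\<delta> * energy (r / \<sigma>) = (\<integral>x. \<delta> * (indicator (ball 0 (r / \<sigma>)) x * w x) \<partial>lebesgue)"
    by (simp add: energy_def)
  also have "\<dots> \<le> G r"
    unfolding G_def
  proof (rule integral_mono)
    show "\<delta> * (indicator (ball 0 (r / \<sigma>)) x * w x) \<le> w x * \<Phi>s r x" for x
      using cutoff_scaled(4)[OF assms, of x] by (cases "x \<in> ball 0 (r / \<sigma>)") auto
  qed (use integrable_w_ball[OF pos(1)] int in auto)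
  finally show "\<delta> * energy (r / \<sigma>) \<le> G r" .
  show "\<Delta> r \<le> G r"
    unfolding G_def \<Delta>_def using int by (intro integral_mono) (auto simp: indicator_def)
  show "0 \<le> \<Delta> r"
    unfolding \<Delta>_def by (intro Bochner_Integration.integral_nonneg) auto
  have "\<Delta> r \<le> (\<integral>x. indicator (ball 0 (\<sigma> * r)) x * w x - indicator (ball 0 (r / \<sigma>)) x * w x \<partial>lebesgue)"
    unfolding \<Delta>_def
  proof (rule integral_mono)
    show "indicator (annulus r) x * (w x * \<Phi>s r x) \<le>
        indicator (ball 0 (\<sigma> * r)) x * w x - indicator (ball 0 (r / \<sigma>)) x * w x" for x
      using sub by (auto simp: annulus_def indicator_def mult_left_le)
  qed (use integrable_w_ball[OF pos(1)] integrable_w_ball[OF pos(2)] int in auto)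
  also have "\<dots> = energy (\<sigma> * r) - energy (r / \<sigma>)"
    unfolding energy_def by (rule Bochner_Integration.integral_diff) (intro integrable_w_ball pos)+
  finally show "\<Delta> r \<le> energy (\<sigma> * r) - energy (r / \<sigma>)" .
qed

text \<open>The powers of r cancel: r times the weight is r^(m lam) r^(n (1 - lam)), where the
  second factor compensates the r^n inside q and the first the r^(-m lam) produced by m derivatives
  of the scaled cutoff. The two bounds on \<Delta> then yield the minimum treated in
  \<open>increment_le_powr_diff\<close>.\<close>

lemma growth:
  assumes "r > 0" "energy (r / \<sigma>) > 0"
  shows "r * (r powr ((real m - real CARD('n)) * lam + real CARD('n) - 1) * qfun lam \<sigma> f r)
    \<le> (2 * Kc / \<delta>) powr lam * (2 powr lam / (lam - 1) + 1 / (1 - 2 powr (1 - lam)))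
        * (energy (r / \<sigma>) powr (1 - lam) - energy (\<sigma> * r) powr (1 - lam))"
proof -
  define x where "x = energy (r / \<sigma>)"
  define y where "y = energy (\<sigma> * r)"
  note eb = energy_bounds[OF assms(1), folded x_def y_def]
  have x: "x > 0" "x \<le> y" using assms(2) eb(3,4) by (auto simp: x_def)
  have pos: "0 \<le> min ((y - x) * x powr - lam) (x powr (1 - lam))" using x by auto
  have "r * (r powr ((real m - real CARD('n)) * lam + real CARD('n) - 1) * qfun lam \<sigma> f r)
      \<le> (2 * Kc / \<delta>) powr lam * min ((y - x) * x powr - lam) (x powr (1 - lam))"
  proof (cases "(\<integral>\<^sup>+ x\<in>annulus r. fpow lam f x \<partial>lebesgue) = \<infinity> \<or> F r = 0")
    case True
    \<comment> \<open>For an infinite integral this is the convention for q; for F r = 0 it is the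
      default value \<open>0 powr s = 0\<close>.\<close>
    then have "qfun lam \<sigma> f r = 0"
      by (auto simp: qfun_def annulus_def F_def Let_def)
    then show ?thesis using mult_nonneg_nonneg[OF _ pos, of "(2 * Kc / \<delta>) powr lam"] by simp
  next
    case False
    then have F: "F r > 0" by (simp add: F_def less_le)
    have q: "qfun lam \<sigma> f r = (F r / r ^ CARD('n)) powr (1 - lam)"
      using False by (simp add: qfun_def annulus_def F_def Let_def)
    have "r ^ CARD('n) = r powr real CARD('n)" using assms(1) by (simp add: powr_realpow)
    then have "(F r / r ^ CARD('n)) powr (1 - lam) = F r powr (1 - lam) / r powr (real CARD('n) * (1 - lam))"
      by (simp add: powr_divide powr_powr)
    moreover have "r * r powr ((real m - real CARD('n)) * lam + real CARD('n) - 1) =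
        r powr (real m * lam) * r powr (real CARD('n) * (1 - lam))"
    proof -
      have "r * r powr ((real m - real CARD('n)) * lam + real CARD('n) - 1) =
          r powr (1 + ((real m - real CARD('n)) * lam + real CARD('n) - 1))"
        using assms(1) by (subst powr_add) simp
      also have "1 + ((real m - real CARD('n)) * lam + real CARD('n) - 1) =
          real m * lam + real CARD('n) * (1 - lam)" by (simp add: algebra_simps)
      finally show ?thesis by (simp add: powr_add)
    qed
    ultimately have "r * (r powr ((real m - real CARD('n)) * lam + real CARD('n) - 1) * qfun lam \<sigma> f r)
        = r powr (real m * lam) * F r powr (1 - lam)"
      using assms(1) unfolding q mult.assoc[symmetric] by simp
    \<comment> \<open>Positivity of the energy enters here: the optimisation divides by G r.\<close>
    also have G: "G r > 0" using mult_pos_pos[OF \<delta> x(1)] eb(1) by linarith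
    have "F r powr (1 - lam) \<le> (2 * (Kc / r ^ m) / G r) powr lam * \<Delta> r"
      using G_le[OF assms(1)] False G F eb Kc_pos lam assms(1)
      by (intro optimize_split) auto
    then have "r powr (real m * lam) * F r powr (1 - lam) \<le>
        r powr (real m * lam) * ((2 * (Kc / r ^ m) / G r) powr lam * \<Delta> r)"
      by (intro mult_left_mono) auto
    also have "\<dots> = (2 * Kc) powr lam * (G r powr - lam * \<Delta> r)"
    proof -
      have "(2 * (Kc / r ^ m) / G r) powr lam = (2 * Kc) powr lam * G r powr - lam / r powr (real m * lam)"
        using assms(1) G Kc_pos
        by (simp add: powr_divide powr_mult powr_minus_divide powr_powr powr_realpow[symmetric])
      then show ?thesis using assms(1) by simp
    qed
    also have "\<dots> \<le> (2 * Kc) powr lam * (\<delta> powr - lam * min ((y - x) * x powr - lam) (x powr (1 - lam)))"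
    proof (rule mult_left_mono)
      have "G r powr - lam \<le> (\<delta> * x) powr - lam"
        using eb(1) \<delta> x lam by (intro powr_mono2') auto
      then have "G r powr - lam * \<Delta> r \<le> (\<delta> * x) powr - lam * (y - x)"
        using eb by (intro mult_mono) auto
      then have 1: "G r powr - lam * \<Delta> r \<le> \<delta> powr - lam * ((y - x) * x powr - lam)"
        by (simp add: powr_mult mult_ac)
      \<comment> \<open>Since \<delta> \<le> 1, the factor \<delta>^(1-lam) is at most
        \<delta>^(-lam), and both bounds on \<Delta> share one constant.\<close>
      have \<delta>1: "\<delta> \<le> 1" using \<Phi>_inner[of 0] \<Phi>01(2)[of 0] \<sigma> by simp
      have "G r powr - lam * \<Delta> r \<le> G r powr - lam * G r"
        using eb by (intro mult_left_mono) auto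
      also have "\<dots> = G r powr (1 - lam)"
        using G by (simp add: powr_diff powr_minus_divide)
      also have "\<dots> \<le> (\<delta> * x) powr (1 - lam)"
        using eb(1) \<delta> x lam by (intro powr_mono2') auto
      also have "\<dots> = \<delta> powr (1 - lam) * x powr (1 - lam)"
        by (simp add: powr_mult)
      also have "\<dots> \<le> \<delta> powr - lam * x powr (1 - lam)"
        using \<delta> \<delta>1 by (intro mult_right_mono powr_mono') auto
      finally show "G r powr - lam * \<Delta> r \<le> \<delta> powr - lam * min ((y - x) * x powr - lam) (x powr (1 - lam))"
        using 1 by (simp add: min_def)
    qed auto
    also have "\<dots> = (2 * Kc / \<delta>) powr lam * min ((y - x) * x powr - lam) (x powr (1 - lam))"
      by (simp add: powr_divide powr_minus_divide)
    finally show ?thesis .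
  qed
  also have "\<dots> \<le> (2 * Kc / \<delta>) powr lam * ((2 powr lam / (lam - 1) + 1 / (1 - 2 powr (1 - lam)))
      * (x powr (1 - lam) - y powr (1 - lam)))"
    using x lam by (intro mult_left_mono increment_le_powr_diff) auto
  finally show ?thesis by (simp add: x_def y_def mult.assoc)
qed

end

lemma (in solution_with_cutoff) energy_mono:
  assumes "0 < R" "R \<le> R'"
  shows "energy R \<le> energy R'"
  unfolding energy_def
proof (rule integral_mono)
  have "ball 0 R \<subseteq> (ball 0 R' :: (real^'n) set)" using assms(2) by (rule subset_ball)
  then show "indicator (ball 0 R) x * w x \<le> indicator (ball 0 R') x * w x" for x
    using w_nonneg by (auto simp: indicator_def)
qed (use integrable_w_ball assms in auto)

text \<open>The balls of radius \<sigma>^k exhaust the space, so countably many null sets suffice; b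
  > 0 turns w = 0 into u = 0.\<close>

lemma (in solution_with_cutoff) solution_eq_0:
  assumes "\<And>k. energy (\<sigma> ^ k) \<le> 0"
  shows "AE x in lebesgue. u x = 0"
proof -
  have "AE x in lebesgue. indicator (ball 0 (\<sigma> ^ k)) x * w x = 0" for k
  proof -
    have pos: "\<sigma> ^ k > 0" using \<sigma> by simp
    have "energy (\<sigma> ^ k) \<ge> 0"
      unfolding energy_def using w_nonneg by (intro Bochner_Integration.integral_nonneg) auto
    then have "(\<integral>x. indicator (ball 0 (\<sigma> ^ k)) x * w x \<partial>lebesgue) = 0"
      using assms[of k] unfolding energy_def by linarith
    then show ?thesis
      using integral_nonneg_eq_0_iff_AE[OF integrable_w_ball[OF pos]] w_nonneg by simp
  qed
  then have "AE x in lebesgue. \<forall>k. indicator (ball 0 (\<sigma> ^ k)) x * w x = 0"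
    unfolding AE_all_countable by blast
  then show ?thesis
  proof eventually_elim
    case (elim x)
    obtain k where "norm x < \<sigma> ^ k" using real_arch_pow[OF \<sigma>] by blast
    then have "x \<in> ball 0 (\<sigma> ^ k)" by simp
    then have "w x = 0" using elim by (metis indicator_simps(1) mult_1)
    then show "u x = 0" using b_pos by (simp add: w_def less_le)
  qed
qed

section \<open>Summation over geometric scales\<close>

text \<open>For r \<ge> 1 both gaps r - r/\<sigma> and \<sigma> r - r are at least \<epsilon> = 1 -
  1/\<sigma>, so the annulus contains a ball of fixed radius \<epsilon> centred on the sphere of
  radius r. Local boundedness of f bounds the negative power from below there.\<close>

lemma annulus_fpow_lower_bound:
  fixes f :: "real^'n::finite \<Rightarrow> real"
  assumes "L_infty_loc f" "\<forall>x. f x \<ge> 0" "lam > 1" "\<sigma> > 1" "R > 0"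
  obtains c where "c > 0"
    "\<And>r. 1 \<le> r \<Longrightarrow> r \<le> R \<Longrightarrow> ennreal c \<le> (\<integral>\<^sup>+ x \<in> ball 0 (\<sigma> * r) - ball 0 (r / \<sigma>). fpow lam f x \<partial>lebesgue)"
proof -
  have "\<sigma> * R > 0" using assms by simp
  then obtain B0 where B0: "AE x in lebesgue. x \<in> ball 0 (\<sigma> * R) \<longrightarrow> \<bar>f x\<bar> \<le> B0"
    using assms(1) unfolding L_infty_loc_def by blast
  \<comment> \<open>The maximum with 1 keeps B positive, as its negative power requires.\<close>
  define B where "B = max B0 1"
  define \<kappa> where "\<kappa> = B powr (- 1 / (lam - 1))"
  define \<epsilon> where "\<epsilon> = 1 - 1 / \<sigma>"
  define v where "v = unit_ball_vol (real DIM(real^'n)) * \<epsilon> ^ DIM(real^'n)"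
  have B: "B > 0" by (simp add: B_def)
  have \<epsilon>: "\<epsilon> > 0" using assms by (simp add: \<epsilon>_def)
  have v: "v > 0" using \<epsilon> by (simp add: v_def)
  have \<kappa>: "\<kappa> > 0" using B by (simp add: \<kappa>_def)
  have "ennreal (\<kappa> * v) \<le> (\<integral>\<^sup>+ x \<in> ball 0 (\<sigma> * r) - ball 0 (r / \<sigma>). fpow lam f x \<partial>lebesgue)"
    if r: "1 \<le> r" "r \<le> R" for r
  proof -
    \<comment> \<open>\<open>undefined\<close> stands for some coordinate direction; any point of
      norm r would do.\<close>
    define z :: "real^'n" where "z = r *\<^sub>R axis undefined 1"
    have z: "norm z = r" using r by (simp add: z_def norm_axis_1)
    have sub: "ball z \<epsilon> \<subseteq> ball 0 (\<sigma> * r) - ball 0 (r / \<sigma>)"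
    proof
      fix y assume "y \<in> ball z \<epsilon>"
      then have "norm (z - y) < \<epsilon>" by (simp add: dist_norm)
      then have y: "norm y < r + \<epsilon>" "r - \<epsilon> < norm y"
        using norm_triangle_ineq2[of z y] norm_triangle_ineq2[of y z] z by (auto simp: norm_minus_commute)
      have "\<epsilon> \<le> r * \<epsilon>" using r \<epsilon> by simp
      also have "r * \<epsilon> = r - r / \<sigma>" by (simp add: \<epsilon>_def algebra_simps)
      finally have 1: "\<epsilon> \<le> r - r / \<sigma>" .
      have "r - r / \<sigma> \<le> \<sigma> * (r - r / \<sigma>)"
        using mult_right_mono[of 1 \<sigma> "r - r / \<sigma>"] assms 1 \<epsilon> by simp
      also have "\<dots> = \<sigma> * r - r" using assms by (simp add: field_simps)
      finally have "\<epsilon> \<le> \<sigma> * r - r" using 1 by simp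
      then show "y \<in> ball 0 (\<sigma> * r) - ball 0 (r / \<sigma>)" using y 1 by simp
    qed
    have "ball 0 (\<sigma> * r) \<subseteq> (ball 0 (\<sigma> * R) :: (real^'n) set)"
      using r assms by (intro subset_ball) simp
    with sub have sub': "ball z \<epsilon> \<subseteq> ball 0 (\<sigma> * R)" by blast
    have "ennreal (\<kappa> * v) = ennreal \<kappa> * emeasure lebesgue (ball z \<epsilon>)"
      using \<epsilon> \<kappa> v by (simp add: v_def ennreal_mult emeasure_ball)
    also have "\<dots> = (\<integral>\<^sup>+ x. ennreal \<kappa> * indicator (ball z \<epsilon>) x \<partial>lebesgue)"
      by (rule nn_integral_cmult_indicator[symmetric]) simp
    also have "\<dots> \<le> (\<integral>\<^sup>+ x \<in> ball 0 (\<sigma> * r) - ball 0 (r / \<sigma>). fpow lam f x \<partial>lebesgue)"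
    proof (rule nn_integral_mono_AE)
      show "AE x in lebesgue. ennreal \<kappa> * indicator (ball z \<epsilon>) x
          \<le> fpow lam f x * indicator (ball 0 (\<sigma> * r) - ball 0 (r / \<sigma>)) x"
        using B0
      proof eventually_elim
        case (elim x)
        show ?case
        proof (cases "x \<in> ball z \<epsilon>")
          case True
          then have x: "x \<in> ball 0 (\<sigma> * r) - ball 0 (r / \<sigma>)" "f x \<le> B"
            using sub sub' elim by (auto simp: B_def)
          have "ennreal \<kappa> \<le> fpow lam f x"
          proof (cases "f x = 0")
            case False
            then have "f x > 0" using assms(2) by (simp add: less_le)
            then show ?thesis
              using x(2) assms(3) by (auto simp: fpow_def \<kappa>_def intro!: ennreal_leI powr_mono2')
          qed (simp add: fpow_def)
          then show ?thesis using True x(1) by simp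
        qed simp
      qed
    qed
    finally show ?thesis .
  qed
  moreover have "\<kappa> * v > 0" using \<kappa> v by simp
  ultimately show thesis using that by blast
qed

text \<open>The exponent 1 - lam is negative, so a lower bound on the integral bounds q from above.
  Bounded ranges of r thus contribute only finitely to the divergent integral.\<close>

lemma qfun_bounded:
  fixes f :: "real^'n::finite \<Rightarrow> real"
  assumes "L_infty_loc f" "\<forall>x. f x \<ge> 0" "lam > 1" "\<sigma> > 1" "R > 0"
  obtains M where "M \<ge> 0" "\<And>r. 1 \<le> r \<Longrightarrow> r \<le> R \<Longrightarrow> qfun lam \<sigma> f r \<le> M"
proof -
  obtain c where c: "c > 0" "\<And>r. 1 \<le> r \<Longrightarrow> r \<le> R \<Longrightarrow>
      ennreal c \<le> (\<integral>\<^sup>+ x \<in> ball 0 (\<sigma> * r) - ball 0 (r / \<sigma>). fpow lam f x \<partial>lebesgue)"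
    using annulus_fpow_lower_bound[OF assms] by blast
  have "qfun lam \<sigma> f r \<le> (c / R ^ CARD('n)) powr (1 - lam)" if r: "1 \<le> r" "r \<le> R" for r
  proof -
    define I where "I = (\<integral>\<^sup>+ x \<in> ball 0 (\<sigma> * r) - ball 0 (r / \<sigma>). fpow lam f x \<partial>lebesgue)"
    show ?thesis
    proof (cases "I = \<infinity>")
      case True
      then show ?thesis by (simp add: qfun_def I_def)
    next
      case False
      then have "c \<le> enn2real I"
        using c(2)[OF r] c(1) enn2real_mono[of "ennreal c" I] by (simp add: I_def less_top)
      then have "c / R ^ CARD('n) \<le> enn2real I / r ^ CARD('n)"
        using r c(1) by (intro frac_le power_mono) auto
      then have "(enn2real I / r ^ CARD('n)) powr (1 - lam) \<le> (c / R ^ CARD('n)) powr (1 - lam)"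
        using c(1) assms by (intro powr_mono2') auto
      then show ?thesis using False by (simp add: qfun_def I_def Let_def)
    qed
  qed
  then show thesis by (intro that[of "(c / R ^ CARD('n)) powr (1 - lam)"]) auto
qed

lemma geometric_interval:
  fixes s r :: real
  assumes "s > 1" "s ^ L \<le> r"
  obtains k where "s ^ (L + k) \<le> r" "r \<le> s ^ (L + Suc k)"
proof -
  obtain n0 where "r < s ^ n0" using real_arch_pow[OF assms(1)] by blast
  also have "s ^ n0 \<le> s ^ (L + n0)" using assms(1) by (intro power_increasing) auto
  finally have ex: "\<exists>n. r < s ^ (L + n)" by blast
  define n where "n = (LEAST n. r < s ^ (L + n))"
  have n: "r < s ^ (L + n)" unfolding n_def by (rule LeastI_ex[OF ex])
  then have "n \<noteq> 0" using assms(2) by (cases n) auto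
  then obtain k where k: "n = Suc k" by (cases n) auto
  have "\<not> r < s ^ (L + k)" using not_less_Least[of k "\<lambda>n. r < s ^ (L + n)"] k by (simp add: n_def)
  then show thesis using that[of k] n k by auto
qed

text \<open>On the k-th block h is at most D (g k - g (k + 3)) / s^(L + k), and the block has length
  (s - 1) s^(L + k). The scale cancels, and the contributions form a convergent telescoping
  series.\<close>

lemma nn_integral_telescoping_finite:
  fixes h :: "real \<Rightarrow> real" and g :: "nat \<Rightarrow> real"
  assumes s: "s > 1" and g: "decseq g" "\<And>k. g k \<ge> 0" and D: "D \<ge> 0"
    and bounded: "\<And>r. 1 \<le> r \<Longrightarrow> r \<le> s ^ L \<Longrightarrow> h r \<le> M"
    and tail: "\<And>k r. s ^ (L + k) \<le> r \<Longrightarrow> r \<le> s ^ (L + Suc k) \<Longrightarrow> r * h r \<le> D * (g k - g (k + 3))"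
  shows "(\<integral>\<^sup>+ r \<in> {1..}. ennreal (h r) \<partial>lborel) < \<infinity>"
proof -
  define c where "c k = D * (g k - g (k + 3)) / s ^ (L + k)" for k
  define J where "J k = {s ^ (L + k) .. s ^ (L + Suc k)}" for k
  have gk: "g (k + 3) \<le> g k" for k using g(1) by (auto intro: decseqD)
  have c0: "c k \<ge> 0" for k using gk[of k] D s by (simp add: c_def)
  have hc: "h r \<le> c k" if "r \<in> J k" for k r
  proof -
    have sk: "s ^ (L + k) > 0" "s ^ (L + k) \<le> r" using s that by (auto simp: J_def)
    then have "r > 0" by linarith
    then have "h r \<le> D * (g k - g (k + 3)) / r"
      using tail[of k r] that by (simp add: J_def pos_le_divide_eq mult.commute)
    also have "\<dots> \<le> c k"
      unfolding c_def using sk gk[of k] D by (intro divide_left_mono) auto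
    finally show ?thesis .
  qed
  have "ennreal (h r) * indicator {1..} r \<le>
      ennreal M * indicator {1..s ^ L} r + (\<Sum>k. ennreal (c k) * indicator (J k) r)" for r
  proof (cases "r < 1 \<or> r \<le> s ^ L")
    case True
    then have "ennreal (h r) * indicator {1..} r \<le> ennreal M * indicator {1..s ^ L} r"
      using bounded[of r] by (auto simp: indicator_def intro: ennreal_leI)
    then show ?thesis by (rule order_trans) simp
  next
    case False
    then have "s ^ L \<le> r" by simp
    from geometric_interval[OF s this] obtain k where k: "r \<in> J k" by (auto simp: J_def)
    have "ennreal (h r) * indicator {1..} r \<le> ennreal (c k) * indicator (J k) r"
      using False k hc[OF k] by (auto intro: ennreal_leI)
    also have "\<dots> \<le> (\<Sum>k. ennreal (c k) * indicator (J k) r)"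
    proof -
      define S where "S = (\<lambda>k. ennreal (c k) * indicator (J k) r)"
      have "S k \<le> suminf S" using sum_le_suminf[of S "{k}"] by simp
      then show ?thesis by (simp only: S_def)
    qed
    finally show ?thesis by (rule order_trans) simp
  qed
  then have "(\<integral>\<^sup>+ r \<in> {1..}. ennreal (h r) \<partial>lborel) \<le>
      (\<integral>\<^sup>+ r. ennreal M * indicator {1..s ^ L} r + (\<Sum>k. ennreal (c k) * indicator (J k) r) \<partial>lborel)"
    by (intro nn_integral_mono) auto
  also have "\<dots> = (\<integral>\<^sup>+ r. ennreal M * indicator {1..s ^ L} r \<partial>lborel)
      + (\<Sum>k. \<integral>\<^sup>+ r. ennreal (c k) * indicator (J k) r \<partial>lborel)"
    by (subst nn_integral_add) (auto simp: J_def nn_integral_suminf)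
  also have "\<dots> < \<infinity>"
  proof -
    have "(\<integral>\<^sup>+ r. ennreal M * indicator {1..s ^ L} r \<partial>lborel) = ennreal M * ennreal (s ^ L - 1)"
      using s by (subst nn_integral_cmult_indicator) (auto simp: one_le_power)
    also have "\<dots> < \<infinity>" by (simp add: ennreal_mult_less_top)
    finally have 1: "(\<integral>\<^sup>+ r. ennreal M * indicator {1..s ^ L} r \<partial>lborel) < \<infinity>" .
    \<comment> \<open>Three consecutive terms are summed so that a difference with step 3 becomes
      one with step 1.\<close>
    define p where "p k = g k + g (Suc k) + g (Suc (Suc k))" for k
    have "decseq p"
      unfolding p_def[abs_def] by (intro decseq_SucI add_mono decseqD[OF g(1)]) auto
    moreover have "p k \<ge> 0" for k by (simp add: p_def g(2))
    ultimately obtain l where "p \<longlonglongrightarrow> l"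
      using decseq_convergent[of p 0] by blast
    then have "summable (\<lambda>k. p k - p (Suc k))" by (rule telescope_summable')
    then have "summable (\<lambda>k. D * (s - 1) * (p k - p (Suc k)))" by (rule summable_mult)
    moreover have "p k - p (Suc k) = g k - g (k + 3)" for k
      by (simp add: p_def numeral_3_eq_3)
    ultimately have sm: "summable (\<lambda>k. D * (s - 1) * (g k - g (k + 3)))" by simp
    have "(\<integral>\<^sup>+ r. ennreal (c k) * indicator (J k) r \<partial>lborel) = ennreal (D * (s - 1) * (g k - g (k + 3)))" for k
    proof -
      have "s ^ (L + k) \<le> s ^ (L + Suc k)" using s by (intro power_increasing) auto
      then have "(\<integral>\<^sup>+ r. ennreal (c k) * indicator (J k) r \<partial>lborel) = ennreal (c k) * ennreal (s ^ (L + Suc k) - s ^ (L + k))"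
        by (subst nn_integral_cmult_indicator) (auto simp: J_def)
      also have "\<dots> = ennreal (c k * (s ^ (L + Suc k) - s ^ (L + k)))"
        using c0 by (subst ennreal_mult') auto
      also have "c k * (s ^ (L + Suc k) - s ^ (L + k)) = D * (s - 1) * (g k - g (k + 3))"
        using s by (simp add: c_def field_simps)
      finally show ?thesis .
    qed
    moreover have "(\<Sum>k. ennreal (D * (s - 1) * (g k - g (k + 3)))) \<noteq> top"
      using sm gk D s by (intro ennreal_suminf_neq_top) auto
    ultimately have 2: "(\<Sum>k. \<integral>\<^sup>+ r. ennreal (c k) * indicator (J k) r \<partial>lborel) < \<infinity>"
      by (simp add: less_top)
    show ?thesis using 1 2 by (simp add: ennreal_add_less_top)
  qed
  finally show ?thesis .
qed

theorem theorem4p2: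
  fixes m :: nat and lam \<sigma> :: real
    and A :: "('n::finite \<Rightarrow> nat) \<Rightarrow> real^'n \<Rightarrow> real \<Rightarrow> real"
    and a b f u :: "real^'n \<Rightarrow> real"
  assumes "m \<ge> 1" and "lam > 1"
    and "b \<in> borel_measurable lebesgue" and "\<forall>x. b x > 0"
    and "a \<in> borel_measurable lebesgue" and "\<forall>x. a x \<ge> 0"
    and "AE x in lebesgue. \<forall>\<alpha>\<in>multi_indices m. \<forall>\<zeta>. \<bar>A \<alpha> x \<zeta>\<bar> \<le> a x * \<bar>\<zeta>\<bar>"
    and "L_infty_loc f" and "\<forall>x. f x \<ge> 0"
    and "AE x in lebesgue. b x \<ge> a x powr lam * f x"
    and "\<sigma> > 1"
    and "(\<integral>\<^sup>+ r \<in> {1..}. ennreal (r powr ((real m - real CARD('n)) * lam + real CARD('n) - 1)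
            * qfun lam \<sigma> f r) \<partial>lborel) = \<infinity>"
    and "is_solution m lam A b u"
  shows "AE x in lebesgue. u x = 0"
proof -
  obtain \<Phi> :: "real^'n \<Rightarrow> real" and \<delta> C :: real
    where \<Phi>: "smooth \<Phi>" "\<delta> > 0" "C > 0" "\<And>x. 0 \<le> \<Phi> x" "\<And>x. \<Phi> x \<le> 1"
    "\<And>x. norm x < 1 / \<sigma> \<Longrightarrow> \<Phi> x = \<delta>" "\<And>x. norm x \<ge> \<sigma> \<Longrightarrow> \<Phi> x = 0"
    "\<And>is x. length is = m \<Longrightarrow> norm x < 1 / \<sigma> \<or> norm x \<ge> \<sigma> \<Longrightarrow> pderivs is \<Phi> x = 0"
    "\<And>is x. length is = m \<Longrightarrow> \<bar>pderivs is \<Phi> x\<bar> \<le> C * \<Phi> x powr (1 / lam)"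
    using cutoff_exists[OF assms(11,2,1)] by metis
  have f_meas: "f \<in> borel_measurable lebesgue" using assms(8) by (simp add: L_infty_loc_def)
  interpret S: solution_with_cutoff m lam \<sigma> \<delta> C A a b f u \<Phi>
    by unfold_locales (fact assms f_meas \<Phi>)+
  show ?thesis
  proof (rule S.solution_eq_0, rule ccontr)
    \<comment> \<open>One ball of positive energy suffices for the contradiction: by monotonicity
      all larger balls have positive energy, and \<open>growth\<close> applies from there
      on.\<close>
    fix L assume "\<not> S.energy (\<sigma> ^ L) \<le> 0"
    then have E: "S.energy (\<sigma> ^ L) > 0" by simp
    define e where "e = (real m - real CARD('n)) * lam + real CARD('n) - 1"
    define h where "h r = r powr e * qfun lam \<sigma> f r" for r
    define D where "D = (2 * S.Kc / \<delta>) powr lam * (2 powr lam / (lam - 1) + 1 / (1 - 2 powr (1 - lam)))"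
    define g where "g k = S.energy (\<sigma> ^ (L + k)) powr (1 - lam)" for k
    have E_pos: "S.energy R > 0" if "\<sigma> ^ L \<le> R" for R
      using less_le_trans[OF E S.energy_mono[OF _ that]] assms(11) by simp
    have g_anti: "S.energy R' powr (1 - lam) \<le> S.energy R powr (1 - lam)"
      if "\<sigma> ^ L \<le> R" "R \<le> R'" for R R'
    proof -
      have "R > 0" using that(1) assms(11) by (intro less_le_trans[OF _ that(1)]) simp
      then show ?thesis
        using E_pos[OF that(1)] S.energy_mono[OF _ that(2)] assms(2) by (intro powr_mono2') auto
    qed
    have "decseq g"
      unfolding decseq_def g_def using assms(11) by (auto intro!: g_anti power_increasing)
    have "2 powr (1 - lam) < 2 powr (0::real)" using assms(2) by (intro powr_less_mono) auto
    then have D: "D \<ge> 0" using assms(2) unfolding D_def by simp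
    \<comment> \<open>The tail starts at \<open>Suc L\<close>, not at \<open>L\<close>, because
      \<open>growth\<close> at radius r needs positive energy at r/\<sigma>.\<close>
    have \<sigma>L: "\<sigma> ^ Suc L > 0" using assms(11) by simp
    obtain M where M: "M \<ge> 0" "\<And>r. 1 \<le> r \<Longrightarrow> r \<le> \<sigma> ^ Suc L \<Longrightarrow> qfun lam \<sigma> f r \<le> M"
      using qfun_bounded[OF assms(8,9,2,11) \<sigma>L] by blast
    have "(\<integral>\<^sup>+ r \<in> {1..}. ennreal (h r) \<partial>lborel) < \<infinity>"
    proof (rule nn_integral_telescoping_finite[OF assms(11) \<open>decseq g\<close> _ D])
      show "g k \<ge> 0" for k by (simp add: g_def)
      \<comment> \<open>The absolute value of e covers both signs of the exponent, as r \<ge>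
        1.\<close>
      show "h r \<le> (\<sigma> ^ Suc L) powr \<bar>e\<bar> * M" if "1 \<le> r" "r \<le> \<sigma> ^ Suc L" for r
      proof -
        have "r powr e \<le> r powr \<bar>e\<bar>" using that by (intro powr_mono) auto
        also have "\<dots> \<le> (\<sigma> ^ Suc L) powr \<bar>e\<bar>" using that by (intro powr_mono2) auto
        finally have "r powr e * qfun lam \<sigma> f r \<le> (\<sigma> ^ Suc L) powr \<bar>e\<bar> * qfun lam \<sigma> f r"
          by (rule mult_right_mono) (simp add: qfun_def Let_def)
        also have "\<dots> \<le> (\<sigma> ^ Suc L) powr \<bar>e\<bar> * M"
          using M(2)[OF that] by (intro mult_left_mono) auto
        finally show ?thesis by (simp add: h_def)
      qed
      show "r * h r \<le> D * (g k - g (k + 3))"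
        if r: "\<sigma> ^ (Suc L + k) \<le> r" "r \<le> \<sigma> ^ (Suc L + Suc k)" for k r
      proof -
        have r0: "r > 0" using assms(11) by (intro less_le_trans[OF _ r(1)]) simp
        \<comment> \<open>The block lies between the exponents L + k + 1 and L + k + 2; dividing or
          multiplying r by \<sigma> adds one on each side, which is the origin of the step
          3.\<close>
        have lo: "\<sigma> ^ (L + k) \<le> r / \<sigma>" using r(1) assms(11) by (simp add: field_simps)
        have hi: "\<sigma> * r \<le> \<sigma> ^ (L + (k + 3))" using r(2) assms(11) by (simp add: numeral_3_eq_3)
        have L: "\<sigma> ^ L \<le> \<sigma> ^ (L + k)" using assms(11) by (intro power_increasing) auto
        have "r / \<sigma> \<le> r" "r \<le> \<sigma> * r" using r0 assms(11) by (auto simp: field_simps)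
        then have lohi: "\<sigma> ^ L \<le> \<sigma> * r" using L lo by linarith
        have "r * h r \<le> D * (S.energy (r / \<sigma>) powr (1 - lam) - S.energy (\<sigma> * r) powr (1 - lam))"
          unfolding h_def e_def D_def by (rule S.growth[OF r0 E_pos[OF order_trans[OF L lo]]])
        also have "\<dots> \<le> D * (g k - g (k + 3))"
          unfolding g_def using D g_anti[OF L lo] g_anti[OF lohi hi] by (intro mult_left_mono) auto
        finally show ?thesis .
      qed
    qed
    then show False using assms(12) by (simp add: h_def e_def)
  qed
qed

end
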